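(* Let $n\in\mathbb{N}$ and let $V$ be the set of all bases of $\mathbb{R}_c^n$. For $B\in V$ consider the shortest independent vectors problem (SIVP) $$\min_{\beta\in\mathcal{B}(B)}\ \sum_{b\in\beta}\|b\|_2,$$ where $\mathcal{B}(B)$ is the set of bases of $\mathbb{R}_c^n$ consisting of vectors of the lattice $\Lambda(B)$, and let $\mathrm{Opt}(B)$ be its set of minimizers. Let $G:V\to V$ be a function such that $G(B)\in\mathrm{Opt}(B)$ for all $B\in V$. Then $G$ is not Banach-Mazur computable. Moreover, all functions $G^*:V\to V$ satisfying $$\|G-G^*\|_\infty\le\alpha<\frac{\sqrt2}{2}$$ are also not Banach-Mazur computable.
   Context: For a basis $B=\{b_1,\dots,b_n\}\subset\mathbb{R}_c^n$ the corresponding lattice is $\Lambda(B)=\{\sum_{i=1}^n\lambda_ib_i\in\mathbb{R}_c^n:\lambda_i\in\mathbb{Z}\text{ for all }i=1,\dots,n\}$, and $\mathcal{B}(B)=\{\beta\subset\Lambda(B):\beta\text{ is a basis of }\mathbb{R}_c^n\}$. Here $\mathbb{R}_c$ is the field of computable reals (defined below), and $\|\cdot\|_2$ is the Euclidean norm. For the purposes of computability and of measuring distances, bases are written as ordered bases, so that $V$ is regarded as a subset of $\mathbb{R}_c^{n^2}$. A function $\mathbb{N}\to\mathbb{N}$ is recursive if it is computed by a Turing machine (similarly for several arguments). A sequence of rationals $(r_k)$ is computable if there are recursive $s,p,q:\mathbb{N}\to\mathbb{N}$ such that $r_k=(-1)^{s(k)}\frac{p(k)}{q(k)}$ for all $k$;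 analogously for double sequences. A real number $x$ is computable if there is a computable rational sequence $(q_k)$ with $|q_k-x|\le2^{-k}$ for all $k$; $\mathbb{R}_c$ denotes the set of computable reals. A real sequence $(x_l)$ is computable if there is a computable rational double sequence $(q_{l,k})$ with $|q_{l,k}-x_l|\le2^{-k}$ for all $l,k$. These notions extend componentwise to vectors. A function $f$ from a subset of $\mathbb{R}_c^N$ to $\mathbb{R}_c^M$ is Banach-Mazur computable if for every computable sequence $(a_k)$ in its domain, the sequence $(f(a_k))$ is computable. $\|G-G^*\|_\infty=\sup_{B\in V}\|G(B)-G^*(B)\|_2$, with the Euclidean norm on $\mathbb{R}^{n^2}$.
   Formalization: The formal theorem assumes n ≥ 2; for n = 1 the claim is false, since Opt(b) = {{b},{−b}} and G(b) = b is an admissible, Banach-Mazur computable choice. *)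

theory Defs
  imports "HOL-Analysis.Analysis"
begin

section \<open>Recursive functions\<close>

text \<open>
  Deterministic multi-tape Turing machines with two-way infinite tapes. States are
  \<open>0, \<dots>, states - 1\<close> (\<open>0\<close> is initial), tape symbols are \<open>0, \<dots>, symbols - 1\<close>
  (\<open>0\<close> is the blank, \<open>1\<close> the stroke). Given a state and the list of scanned symbols, \<open>delta\<close>
  returns the next state and, for each tape, the symbol to write and the head movement;
  \<open>None\<close> means that the machine halts. For a well-formed machine only the finitely many values of
  \<open>delta\<close> at the arguments considered in \<open>tm_wf\<close> ever matter.
\<close>

record tm =
  tapes :: nat
  states :: nat
  symbols :: nat
  delta :: "nat \<Rightarrow> nat list \<Rightarrow> (nat \<times> (nat \<times> int) list) option"

definition tm_wf :: "tm \<Rightarrow> bool" where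
  "tm_wf M \<longleftrightarrow> 0 < states M \<and> 2 \<le> symbols M \<and>
     (\<forall>q syms q' acts. q < states M \<and> length syms = tapes M \<and> set syms \<subseteq> {..<symbols M} \<and>
        delta M q syms = Some (q', acts) \<longrightarrow>
        q' < states M \<and> length acts = tapes M \<and> set acts \<subseteq> {..<symbols M} \<times> {-1, 0, 1})"

record config =
  cstate :: nat
  content :: "nat \<Rightarrow> int \<Rightarrow> nat"
  head :: "nat \<Rightarrow> int"

definition scanned :: "tm \<Rightarrow> config \<Rightarrow> nat list" where
  "scanned M c = map (\<lambda>i. content c i (head c i)) [0..<tapes M]"

definition tm_step :: "tm \<Rightarrow> config \<Rightarrow> config option" where
  "tm_step M c = map_option (\<lambda>(q, acts).
     \<lparr>cstate = q,
      content = (\<lambda>i. if i < tapes M then (content c i)(head c i := fst (acts ! i)) else content c i),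
      head = (\<lambda>i. if i < tapes M then head c i + snd (acts ! i) else head c i)\<rparr>)
     (delta M (cstate c) (scanned M c))"

definition unary :: "nat \<Rightarrow> int \<Rightarrow> nat" where
  "unary x z = (if 0 \<le> z \<and> z < int x then 1 else 0)"

text \<open>
  The arguments are written in unary on the tapes \<open>0, \<dots>, m - 1\<close>; all other tapes are blank.
  On halting, tape \<open>m\<close> must contain exactly the unary representation of the result.
\<close>

definition initial :: "nat list \<Rightarrow> config" where
  "initial xs =
     \<lparr>cstate = 0, content = (\<lambda>i. if i < length xs then unary (xs ! i) else (\<lambda>_. 0)), head = (\<lambda>_. 0)\<rparr>"

definition computes :: "tm \<Rightarrow> nat \<Rightarrow> (nat list \<Rightarrow> nat) \<Rightarrow> bool" where
  "computes M m f \<longleftrightarrow> m < tapes M \<and>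
     (\<forall>xs. length xs = m \<longrightarrow>
        (\<exists>c. rtranclp (\<lambda>c c'. tm_step M c = Some c') (initial xs) c \<and>
             tm_step M c = None \<and> content c m = unary (f xs)))"

definition recursive1 :: "(nat \<Rightarrow> nat) \<Rightarrow> bool" where
  "recursive1 f \<longleftrightarrow> (\<exists>M. tm_wf M \<and> computes M 1 (\<lambda>xs. f (xs ! 0)))"

definition recursive2 :: "(nat \<Rightarrow> nat \<Rightarrow> nat) \<Rightarrow> bool" where
  "recursive2 f \<longleftrightarrow> (\<exists>M. tm_wf M \<and> computes M 2 (\<lambda>xs. f (xs ! 0) (xs ! 1)))"

section \<open>Computable reals and Banach-Mazur computability\<close>

definition computable_rat_seq :: "(nat \<Rightarrow> real) \<Rightarrow> bool" where
  "computable_rat_seq r \<longleftrightarrow>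
     (\<exists>s p q. recursive1 s \<and> recursive1 p \<and> recursive1 q \<and>
        (\<forall>k. q k \<noteq> 0 \<and> r k = (-1) ^ s k * (real (p k) / real (q k))))"

definition computable_rat_seq2 :: "(nat \<Rightarrow> nat \<Rightarrow> real) \<Rightarrow> bool" where
  "computable_rat_seq2 r \<longleftrightarrow>
     (\<exists>s p q. recursive2 s \<and> recursive2 p \<and> recursive2 q \<and>
        (\<forall>l k. q l k \<noteq> 0 \<and> r l k = (-1) ^ s l k * (real (p l k) / real (q l k))))"

definition Rc :: "real set" where
  "Rc = {x. \<exists>r. computable_rat_seq r \<and> (\<forall>k. \<bar>r k - x\<bar> \<le> 1 / 2 ^ k)}"

definition computable_real_seq :: "(nat \<Rightarrow> real) \<Rightarrow> bool" where
  "computable_real_seq x \<longleftrightarrow>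
     (\<exists>r. computable_rat_seq2 r \<and> (\<forall>l k. \<bar>r l k - x l\<bar> \<le> 1 / 2 ^ k))"

text \<open>
  Inner products with the elements of \<^const>\<open>Basis\<close> are the coordinates, also for
  \<open>real ^ 'n ^ 'n\<close>, where they are the matrix entries.
\<close>

definition computable_vec_seq :: "(nat \<Rightarrow> 'a::euclidean_space) \<Rightarrow> bool" where
  "computable_vec_seq a \<longleftrightarrow> (\<forall>e\<in>Basis. computable_real_seq (\<lambda>k. a k \<bullet> e))"

definition banach_mazur_computable_on ::
  "'a::euclidean_space set \<Rightarrow> ('a \<Rightarrow> 'b::euclidean_space) \<Rightarrow> bool" where
  "banach_mazur_computable_on D f \<longleftrightarrow>
     (\<forall>a. (\<forall>k. a k \<in> D) \<and> computable_vec_seq a \<longrightarrow> computable_vec_seq (\<lambda>k. f (a k)))"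

section \<open>Bases over the computable reals, lattices and the SIVP\<close>

definition Rc_vectors :: "(real ^ 'n) set" where
  "Rc_vectors = {x. \<forall>i. x $ i \<in> Rc}"

text \<open>Linear independence and spanning are taken over the field \<^const>\<open>Rc\<close>, not over the reals.\<close>

definition Rc_independent :: "(real ^ 'n) set \<Rightarrow> bool" where
  "Rc_independent \<beta> \<longleftrightarrow>
     (\<forall>c. (\<forall>b\<in>\<beta>. c b \<in> Rc) \<and> (\<Sum>b\<in>\<beta>. c b *\<^sub>R b) = 0 \<longrightarrow> (\<forall>b\<in>\<beta>. c b = 0))"

definition Rc_span :: "(real ^ 'n) set \<Rightarrow> (real ^ 'n) set" where
  "Rc_span \<beta> = {(\<Sum>b\<in>\<beta>. c b *\<^sub>R b) |c. \<forall>b\<in>\<beta>. c b \<in> Rc}"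

definition Rc_basis :: "(real ^ 'n) set \<Rightarrow> bool" where
  "Rc_basis \<beta> \<longleftrightarrow>
     finite \<beta> \<and> \<beta> \<subseteq> Rc_vectors \<and> Rc_independent \<beta> \<and> Rc_span \<beta> = Rc_vectors"

text \<open>
  An ordered basis \<open>(b\<^sub>1, \<dots>, b\<^sub>n)\<close> is the matrix \<open>B\<close> with rows \<open>B $ i\<close>. The library norm on
  \<open>real ^ 'n ^ 'n\<close> is the Euclidean norm of the vector of its entries.
\<close>

definition basis_set :: "real ^ 'n ^ 'n \<Rightarrow> (real ^ 'n) set" where
  "basis_set B = range (\<lambda>i. B $ i)"

definition ordered_bases :: "(real ^ 'n ^ 'n) set" where
  "ordered_bases = {B. inj (\<lambda>i. B $ i) \<and> Rc_basis (basis_set B)}"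

definition lattice_of :: "real ^ 'n ^ 'n \<Rightarrow> (real ^ 'n) set" where
  "lattice_of B = {(\<Sum>i\<in>UNIV. of_int (l i) *\<^sub>R (B $ i)) |l :: 'n \<Rightarrow> int. True}"

definition lattice_bases :: "real ^ 'n ^ 'n \<Rightarrow> (real ^ 'n) set set" where
  "lattice_bases B = {\<beta>. \<beta> \<subseteq> lattice_of B \<and> Rc_basis \<beta>}"

definition SIVP_opt :: "real ^ 'n ^ 'n \<Rightarrow> (real ^ 'n) set set" where
  "SIVP_opt B = {\<beta>. is_arg_min (\<lambda>\<beta>. \<Sum>b\<in>\<beta>. norm b) (\<lambda>\<beta>. \<beta> \<in> lattice_bases B) \<beta>}"

text \<open>The supremum is formed in the extended reals, as it may be infinite.\<close>

definition sup_dist_on :: "'a set \<Rightarrow> ('a \<Rightarrow> 'b::real_normed_vector) \<Rightarrow> ('a \<Rightarrow> 'b) \<Rightarrow> ereal" where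
  "sup_dist_on D f g = (SUP x\<in>D. ereal (norm (f x - g x)))"

end

theory Submission
  imports Defs
begin

text \<open>
  Let \<open>B(y)\<close> be 8 times the identity with one extra entry \<open>y\<close>, in row \<open>q\<close> and column \<open>p\<close>. The
  vectors \<open>(y, 8)\<close> and \<open>(y - 8, 8)\<close> of the \<open>(p, q)\<close> plane both complete \<open>8 e\<^sub>j\<close> (\<open>j \<noteq> q\<close>) to a basis, and the
  solutions of the SIVP use the shorter one: the first for \<open>y < 4\<close>, the second for \<open>y > 4\<close>, and
  either for \<open>y = 4\<close>. So \<open>G(B(4))\<close> is, regardless of signs and order, far from \<open>G(B(y))\<close> for \<open>y\<close> on one
  side of 4, and so is \<open>G'\<close> for every \<open>G'\<close> within distance 1 of \<open>G\<close>. Approach 4 from this side along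
  \<open>y\<^sub>l = 4 \<plusminus> x\<^sub>l\<close>, where \<open>x\<^sub>l = 2\<^sup>-\<^sup>t\<close> if \<open>t\<close> is the first number that witnesses the halting of the
  \<open>l\<close>-th machine on its own code and \<open>x\<^sub>l = 0\<close> if there is none. This sequence is computable, but
  approximations to \<open>G'(B(y\<^sub>l))\<close> would decide the halting problem.
\<close>

section \<open>A register language and its compilation to Turing machines\<close>

text \<open>Turing machines are met on both sides of the argument: the sequence of bases must be
  produced by machines, and the assumed computability of \<open>G'\<close> along it yields unknown
  machines that have to be run inside a decision procedure. Hence the class \<open>cf\<close>,
  convenient to program in, is shown to agree with Turing computability for one and two arguments;
  the universal predicate used for this also carries the diagonal argument.

  Nothing is known about how \<open>G\<close> chooses, so the side from which 4 is approached cannot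
  be computed. It is one bit of information about \<open>G(B(4))\<close>; like the integers close to
  the entries of \<open>G'(B(4))\<close>, it is a constant whose mere existence suffices for an
  algorithm to exist.

  The scale 8 is an error budget. Some entry of \<open>G(B(4))\<close> and \<open>G(B(y))\<close>
  differs by at least 7; passing to \<open>G'\<close> costs 1 for each matrix and rounding the
  entries of \<open>G'(B(4))\<close> to integers costs 1 more. This leaves 4, against at most 1 if
  the machine does not halt.

  In dimension 1 the identity is a computable solution; the competition takes place between two
  coordinates.\<close>

datatype instr = INC nat | DJZ nat nat | JMP nat

text \<open>Sums of these values bound the numbers of tapes and states; the \<open>0\<close> for a
  missing operand adds nothing.\<close>

fun instr_reg :: "instr \<Rightarrow> nat" where
  "instr_reg (INC r) = r"
| "instr_reg (DJZ r l) = r"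
| "instr_reg (JMP l) = 0"

fun instr_label :: "instr \<Rightarrow> nat" where
  "instr_label (INC r) = 0"
| "instr_label (DJZ r l) = l"
| "instr_label (JMP l) = l"

fun instr_step :: "instr \<Rightarrow> nat \<times> (nat \<Rightarrow> nat) \<Rightarrow> nat \<times> (nat \<Rightarrow> nat)" where
  "instr_step (INC r) (p, s) = (Suc p, s(r := Suc (s r)))"
| "instr_step (DJZ r l) (p, s) = (if s r = 0 then (l, s) else (Suc p, s(r := s r - 1)))"
| "instr_step (JMP l) (p, s) = (l, s)"

inductive run :: "instr list \<Rightarrow> nat \<times> (nat \<Rightarrow> nat) \<Rightarrow> nat \<times> (nat \<Rightarrow> nat) \<Rightarrow> bool" for P where
  run_refl: "run P x x"
| run_step: "fst x < length P \<Longrightarrow> run P (instr_step (P ! fst x) x) y \<Longrightarrow> run P x y"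

lemma run_trans: "run P x y \<Longrightarrow> run P y z \<Longrightarrow> run P x z"
  by (induction rule: run.induct) (auto intro: run.intros)

lemma run_instr: "p < length P \<Longrightarrow> instr_step (P ! p) (p, s) = y \<Longrightarrow> run P (p, s) y"
  using run_step[of "(p, s)" P y] by (auto intro: run_refl)

text \<open>
  Register \<open>i\<close> lives in unary on tape \<open>i\<close>, with the head on the last stroke (on cell
  \<open>-1\<close> if the register is \<open>0\<close>), so that the scanned symbol tells whether it is \<open>0\<close>. State
  \<open>0\<close> moves the heads there from the start of the input; \<open>2 * p + 1\<close> begins instruction \<open>p\<close>,
  and \<open>2 * p + 2\<close> is the second half of an increment.
\<close>

definition stay :: "nat \<Rightarrow> nat list \<Rightarrow> (nat \<times> int) list" where
  "stay K syms = map (\<lambda>i. (syms ! i, 0)) [0..<K]"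

fun reg_delta :: "nat \<Rightarrow> instr list \<Rightarrow> nat \<Rightarrow> nat list \<Rightarrow> (nat \<times> (nat \<times> int) list) option" where
  "reg_delta K P 0 syms =
     (if \<forall>x\<in>set syms. x = 0 then Some (1, map (\<lambda>i. (0, -1)) [0..<K])
      else Some (0, map (\<lambda>i. (syms ! i, if syms ! i = 0 then 0 else 1)) [0..<K]))"
| "reg_delta K P (Suc q) syms =
     (if q div 2 < length P then
        if even q then
          case P ! (q div 2) of
            INC r \<Rightarrow> Some (Suc (Suc q), map (\<lambda>i. (syms ! i, if i = r then 1 else 0)) [0..<K])
          | DJZ r l \<Rightarrow>
              if syms ! r = 0 then Some (Suc (2 * l), stay K syms)
              else Some (Suc (Suc (Suc q)),
                map (\<lambda>i. if i = r then (0, -1) else (syms ! i, 0)) [0..<K])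
          | JMP l \<Rightarrow> Some (Suc (2 * l), stay K syms)
        else
          case P ! (q div 2) of
            INC r \<Rightarrow> Some (Suc (Suc q), map (\<lambda>i. (if i = r then 1 else syms ! i, 0)) [0..<K])
          | _ \<Rightarrow> None
      else None)"

text \<open>A program counter is at most the program length or some jump label, and counter
  \<open>p\<close> uses no state above \<open>2 * p + 2\<close>. The sum of all labels is a crude
  bound for the largest one.\<close>

definition reg_tm :: "nat \<Rightarrow> instr list \<Rightarrow> tm" where
  "reg_tm K P = \<lparr>tapes = K, states = 2 * (length P + sum_list (map instr_label P)) + 4,
     symbols = 2, delta = reg_delta K P\<rparr>"

lemma reg_tm_simps [simp]:
  "tapes (reg_tm K P) = K" "symbols (reg_tm K P) = 2" "delta (reg_tm K P) = reg_delta K P"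
  by (auto simp: reg_tm_def)

lemma tm_wf_reg_tm: "tm_wf (reg_tm K P)"
  unfolding tm_wf_def
proof (intro conjI allI impI, goal_cases)
  case 1 show ?case by (simp add: reg_tm_def)
next
  case 2 show ?case by simp
next
  case (3 q syms q' acts)
  have lab: "instr_label (P ! p) \<le> sum_list (map instr_label P)" if "p < length P" for p
    using that by (intro member_le_sum_list) auto
  show ?case
  proof (cases q)
    case 0
    then show ?thesis using 3 by (auto simp: reg_tm_def split: if_splits)
  next
    case (Suc p)
    have "p div 2 < length P"
      using 3 Suc by (auto split: if_splits)
    moreover from this have "p div 2 + 1 \<le> length P + sum_list (map instr_label P)"
      by simp
    then have "p + 3 < states (reg_tm K P)"
      by (simp add: reg_tm_def)
    ultimately show ?thesis using 3 Suc lab[of "p div 2"]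
      by (auto simp: reg_tm_def split: if_splits instr.splits)
  qed
next
  case (4 q syms q' acts)
  then show ?case
    by (cases q) (auto simp: stay_def split: if_splits instr.splits)
next
  case (5 q syms q' acts)
  then have "syms ! i \<in> {..<2}" if "i < K" for i
    using that by (metis nth_mem reg_tm_simps(1,2) subsetD)
  with 5 show ?case
    by (cases q) (auto simp: stay_def split: if_splits instr.splits)
qed

definition reg_config :: "nat \<Rightarrow> nat \<Rightarrow> (nat \<Rightarrow> nat) \<Rightarrow> config" where
  "reg_config K q s = \<lparr>cstate = q,
     content = (\<lambda>i. if i < K then unary (s i) else (\<lambda>_. 0)),
     head = (\<lambda>i. if i < K then int (s i) - 1 else 0)\<rparr>"

lemma unary_last: "unary x (int x - 1) = (if x = 0 then 0 else 1)"
  by (simp add: unary_def)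

lemma unary_update_pred: "x \<noteq> 0 \<Longrightarrow> (unary x)(int x - 1 := 0) = unary (x - Suc 0)"
  by (auto simp: unary_def fun_eq_iff)

abbreviation tm_steps :: "tm \<Rightarrow> config \<Rightarrow> config \<Rightarrow> bool" where
  "tm_steps M \<equiv> rtranclp (\<lambda>c c'. tm_step M c = Some c')"

lemma reg_tm_instr:
  assumes p: "p < length P" and r: "\<forall>I\<in>set P. instr_reg I < K"
    and st: "instr_step (P ! p) (p, s) = (p', s')"
  shows "tm_steps (reg_tm K P) (reg_config K (2 * p + 1) s) (reg_config K (2 * p' + 1) s')"
proof (cases "P ! p")
  case (INC r)
  then have rK: "r < K" using r p by (metis instr_reg.simps(1) nth_mem)
  have e: "p' = Suc p" "s' = s(r := Suc (s r))" using st INC by auto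
  \<comment> \<open>A machine step writes before it moves, so an increment takes two steps. In
    between, the head of tape \<open>r\<close> is on the blank cell after the last stroke.\<close>
  let ?c = "\<lparr>cstate = 2 * p + 2, content = (\<lambda>i. if i < K then unary (s i) else (\<lambda>_. 0)),
     head = (\<lambda>i. if i < K then if i = r then int (s i) else int (s i) - 1 else 0)\<rparr>"
  have 1: "tm_step (reg_tm K P) (reg_config K (2 * p + 1) s) = Some ?c"
    using INC p by (auto simp: tm_step_def reg_config_def scanned_def fun_eq_iff)
  have 2: "tm_step (reg_tm K P) ?c = Some (reg_config K (2 * p' + 1) s')"
    using INC p rK
    by (auto simp: tm_step_def reg_config_def scanned_def fun_eq_iff e unary_def)
  show ?thesis using 1 2 by (meson converse_rtranclp_into_rtranclp r_into_rtranclp)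
next
  case (DJZ r l)
  then have rK: "r < K" using r p by (metis instr_reg.simps(2) nth_mem)
  have "tm_step (reg_tm K P) (reg_config K (2 * p + 1) s) = Some (reg_config K (2 * p' + 1) s')"
    using DJZ p rK st
    by (auto simp: tm_step_def reg_config_def scanned_def fun_eq_iff unary_last stay_def
        unary_update_pred split: if_splits) (auto simp: unary_def)
  then show ?thesis by auto
next
  case (JMP l)
  have "tm_step (reg_tm K P) (reg_config K (2 * p + 1) s) = Some (reg_config K (2 * p' + 1) s')"
    using JMP p st
    by (auto simp: tm_step_def reg_config_def scanned_def fun_eq_iff stay_def)
  then show ?thesis by auto
qed

lemma reg_tm_run:
  assumes "run P x y" and "\<forall>I\<in>set P. instr_reg I < K"
  shows "tm_steps (reg_tm K P) (reg_config K (2 * fst x + 1) (snd x)) (reg_config K (2 * fst y + 1) (snd y))"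
  using assms(1)
proof (induction rule: run.induct)
  case (run_step x y)
  then show ?case
    using rtranclp_trans[OF reg_tm_instr[OF run_step(1) assms(2), of "snd x", OF prod.collapse[symmetric]]]
    by simp
qed simp

definition regs :: "nat list \<Rightarrow> nat \<Rightarrow> nat" where
  "regs xs i = (if i < length xs then xs ! i else 0)"

text \<open>After \<open>k\<close> steps the head on tape \<open>i\<close> is at the end of the input or has moved \<open>k\<close> cells.\<close>

definition input_config :: "nat \<Rightarrow> nat list \<Rightarrow> nat \<Rightarrow> config" where
  "input_config K xs k = \<lparr>cstate = 0,
     content = (\<lambda>i. if i < K then unary (regs xs i) else (\<lambda>_. 0)),
     head = (\<lambda>i. if i < K then int (min k (regs xs i)) else 0)\<rparr>"

lemma reg_tm_initial:
  assumes "length xs \<le> K"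
  shows "tm_steps (reg_tm K P) (initial xs) (reg_config K 1 (regs xs))"
proof -
  let ?c = "input_config K xs"
  define N where "N = sum_list xs"
  have le: "regs xs i \<le> N" for i
    by (simp add: regs_def N_def member_le_sum_list)
  have 0: "initial xs = ?c 0"
    using assms by (auto simp: initial_def input_config_def fun_eq_iff regs_def unary_def)
  have scan: "scanned (reg_tm K P) (?c k) = map (\<lambda>i. if k < regs xs i then 1 else 0) [0..<K]" for k
    by (auto simp: scanned_def input_config_def unary_def)
  have step: "tm_steps (reg_tm K P) (?c k) (?c (Suc k))" for k
  \<comment> \<open>Once all heads are past the input, \<open>?c\<close> no longer changes with
    \<open>k\<close> and the empty run suffices. This allows counting up to the uniform bound
    \<open>N\<close>, although the machine may leave state \<open>0\<close> earlier.\<close>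
  proof (cases "\<forall>i<K. regs xs i \<le> k")
    case True
    then have "min k (regs xs i) = min (Suc k) (regs xs i)" if "i < K" for i
      using that by (simp add: min_absorb2 le_SucI)
    then have "?c k = ?c (Suc k)"
      by (simp add: input_config_def fun_eq_iff)
    then show ?thesis by simp
  next
    case False
    then have "\<not> (\<forall>x\<in>set (scanned (reg_tm K P) (?c k)). x = 0)"
      unfolding scan by (auto simp: not_le)
    moreover have "map (\<lambda>i. (scanned (reg_tm K P) (?c k) ! i,
         if scanned (reg_tm K P) (?c k) ! i = 0 then 0 else 1)) [0..<K] =
       map (\<lambda>i. if k < regs xs i then (1, 1 :: int) else (0, 0)) [0..<K]"
      unfolding scan by (intro map_cong refl) auto
    ultimately have "delta (reg_tm K P) 0 (scanned (reg_tm K P) (?c k)) =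
       Some (0, map (\<lambda>i. if k < regs xs i then (1, 1) else (0, 0)) [0..<K])"
      by (simp only: reg_tm_simps reg_delta.simps if_False)
    then have "tm_step (reg_tm K P) (?c k) = Some (?c (Suc k))"
      by (auto simp: tm_step_def input_config_def fun_eq_iff unary_def)
    then show ?thesis by auto
  qed
  have "tm_steps (reg_tm K P) (?c 0) (?c k)" for k
    by (induction k) (auto intro: rtranclp_trans[OF _ step])
  moreover have "tm_step (reg_tm K P) (?c N) = Some (reg_config K 1 (regs xs))"
  proof -
    have "delta (reg_tm K P) 0 (scanned (reg_tm K P) (?c N)) = Some (1, map (\<lambda>i. (0, -1)) [0..<K])"
    proof -
      have "\<forall>x\<in>set (scanned (reg_tm K P) (?c N)). x = 0"
        unfolding scan using leD[OF le] by auto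
      then show ?thesis by simp
    qed
    then show ?thesis
      by (simp add: tm_step_def input_config_def reg_config_def fun_eq_iff unary_def min_absorb2[OF le])
  qed
  ultimately show ?thesis unfolding 0 by (meson rtranclp.rtrancl_into_rtrancl)
qed

lemma reg_tm_computes:
  assumes "\<And>xs. length xs = m \<Longrightarrow> \<exists>s. run P (0, regs xs) (length P, s) \<and> s m = f xs"
  shows "\<exists>M. tm_wf M \<and> computes M m f"
proof -
  define K where "K = m + Suc (sum_list (map instr_reg P))"
  have r: "\<forall>I\<in>set P. instr_reg I < K"
    by (auto simp: K_def intro!: le_imp_less_Suc trans_le_add2 member_le_sum_list)
  have "computes (reg_tm K P) m f"
    unfolding computes_def
  proof (intro conjI allI impI)
    show "m < tapes (reg_tm K P)" by (simp add: K_def)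
    fix xs :: "nat list" assume xs: "length xs = m"
    obtain s where s: "run P (0, regs xs) (length P, s)" "s m = f xs"
      using assms xs by blast
    let ?c = "reg_config K (2 * length P + 1) s"
    have "tm_steps (reg_tm K P) (initial xs) ?c"
      using reg_tm_initial[of xs K P] reg_tm_run[OF s(1) r] xs by (simp add: K_def)
    moreover have "tm_step (reg_tm K P) ?c = None"
      by (simp add: tm_step_def reg_config_def)
    moreover have "content ?c m = unary (f xs)"
      using s(2) by (simp add: reg_config_def K_def)
    ultimately show "\<exists>c. tm_steps (reg_tm K P) (initial xs) c \<and>
        tm_step (reg_tm K P) c = None \<and> content c m = unary (f xs)" by blast
  qed
  then show ?thesis using tm_wf_reg_tm by blast
qed

section \<open>Structured programs with loops\<close>

datatype com = Skip | Inc nat | Seq com com | Loop nat com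

text \<open>The decrement belongs to the test, before the body. A body that leaves \<open>r\<close>
  alone gives a counting loop, one that sets \<open>r\<close> again gives an unbounded search.
  Divergence is the absence of a derivation.\<close>

inductive exec :: "com \<Rightarrow> (nat \<Rightarrow> nat) \<Rightarrow> (nat \<Rightarrow> nat) \<Rightarrow> bool" where
  Skip: "exec Skip s s"
| Inc: "exec (Inc r) s (s(r := Suc (s r)))"
| Seq: "exec c s s' \<Longrightarrow> exec d s' s'' \<Longrightarrow> exec (Seq c d) s s''"
| Loop_end: "s r = 0 \<Longrightarrow> exec (Loop r c) s s"
| Loop_step: "s r \<noteq> 0 \<Longrightarrow> exec c (s(r := s r - 1)) s' \<Longrightarrow> exec (Loop r c) s' s'' \<Longrightarrow>
    exec (Loop r c) s s''"

fun csize :: "com \<Rightarrow> nat" where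
  "csize Skip = 0"
| "csize (Inc r) = 1"
| "csize (Seq c d) = csize c + csize d"
| "csize (Loop r c) = csize c + 2"

text \<open>Jump targets are absolute, hence the start address as an argument; \<open>csize\<close>
  gives the exit address of a loop before its body is compiled.\<close>

fun compile :: "nat \<Rightarrow> com \<Rightarrow> instr list" where
  "compile p Skip = []"
| "compile p (Inc r) = [INC r]"
| "compile p (Seq c d) = compile p c @ compile (p + csize c) d"
| "compile p (Loop r c) = DJZ r (p + csize c + 2) # compile (Suc p) c @ [JMP p]"

lemma length_compile [simp]: "length (compile p c) = csize c"
  by (induction c arbitrary: p) auto

definition code_at :: "instr list \<Rightarrow> nat \<Rightarrow> instr list \<Rightarrow> bool" where
  "code_at P p Q \<longleftrightarrow> (\<exists>P1 P2. P = P1 @ Q @ P2 \<and> length P1 = p)"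

lemma code_at_append:
  "code_at P p (Q @ R) \<Longrightarrow> code_at P p Q \<and> code_at P (p + length Q) R"
  unfolding code_at_def by (metis append.assoc length_append)

lemma code_at_Cons:
  assumes "code_at P p (I # R)"
  shows "p < length P" "P ! p = I" "code_at P (Suc p) R"
proof -
  obtain P1 P2 where P: "P = P1 @ (I # R) @ P2" "length P1 = p"
    using assms unfolding code_at_def by blast
  then show "p < length P" "P ! p = I" by (auto simp: nth_append)
  have "P = (P1 @ [I]) @ R @ P2" "length (P1 @ [I]) = Suc p" using P by auto
  then show "code_at P (Suc p) R" unfolding code_at_def by blast
qed

lemma run_compile:
  "exec c s s' \<Longrightarrow> code_at P p (compile p c) \<Longrightarrow> run P (p, s) (p + csize c, s')"
proof (induction arbitrary: p rule: exec.induct)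
  case (Skip s)
  then show ?case by (simp add: run_refl)
next
  case (Inc r s)
  then show ?case using code_at_Cons[of P p "INC r" "[]"] by (intro run_instr) auto
next
  case (Seq c s s' d s'')
  then have "code_at P p (compile p c)" "code_at P (p + csize c) (compile (p + csize c) d)"
    using code_at_append[of P p "compile p c" "compile (p + csize c) d"] by auto
  then have "run P (p, s) (p + csize c, s')" "run P (p + csize c, s') (p + csize c + csize d, s'')"
    using Seq.IH by blast+
  then show ?case using run_trans by (fastforce simp: add.assoc)
next
  case (Loop_end s r c)
  from code_at_Cons[OF Loop_end(2)[simplified]] Loop_end(1) show ?case
    by (intro run_instr) (auto simp: add.commute)
next
  case (Loop_step s r c s' s'')
  have Q: "code_at P p (DJZ r (p + csize c + 2) # compile (Suc p) c @ [JMP p])"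
    using Loop_step.prems by simp
  note 1 = code_at_Cons[OF Q]
  have 2: "code_at P (Suc p) (compile (Suc p) c)" "code_at P (Suc p + csize c) [JMP p]"
    using code_at_append[OF 1(3)] by auto
  note 3 = code_at_Cons[OF 2(2)]
  have "run P (Suc p, s(r := s r - 1)) (Suc p + csize c, s')"
    by (rule Loop_step.IH(1)[OF 2(1)])
  moreover have "run P (Suc p + csize c, s') (p, s')"
    using 3 by (intro run_instr) auto
  moreover have "run P (p, s) (Suc p, s(r := s r - 1))"
    using 1 Loop_step(1) by (intro run_instr) auto
  ultimately have "run P (p, s) (p, s')"
    using run_trans by blast
  then show ?case using Loop_step.IH(2)[OF Loop_step.prems] run_trans by blast
qed

lemma exec_computes:
  assumes "\<And>xs. length xs = m \<Longrightarrow> \<exists>s. exec c (regs xs) s \<and> s m = f xs"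
  shows "\<exists>M. tm_wf M \<and> computes M m f"
proof (rule reg_tm_computes)
  fix xs :: "nat list" assume "length xs = m"
  then obtain s where s: "exec c (regs xs) s" "s m = f xs" using assms by blast
  have "code_at (compile 0 c) 0 (compile 0 c)"
    unfolding code_at_def by (metis append_Nil append_Nil2 list.size(3))
  from run_compile[OF s(1) this] s(2)
  show "\<exists>s. run (compile 0 c) (0, regs xs) (length (compile 0 c), s) \<and> s m = f xs" by auto
qed

text \<open>\<open>S k\<close> is the store at the loop test when \<open>k\<close> rounds remain, so
  a counting loop is verified by exhibiting the family \<open>S\<close>.\<close>

lemma exec_Loop_iter:
  assumes "\<And>k. k < n \<Longrightarrow> exec c ((S (Suc k))(r := k)) (S k)" and "\<And>k. k \<le> n \<Longrightarrow> S k r = k"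
  shows "exec (Loop r c) (S n) (S 0)"
  using assms
proof (induction n)
  case 0
  then show ?case by (auto intro: Loop_end)
next
  case (Suc n)
  have "S (Suc n) r = Suc n" using Suc.prems(2) by blast
  moreover have "exec c ((S (Suc n))(r := n)) (S n)" by (rule Suc.prems(1)) simp
  moreover have "exec (Loop r c) (S n) (S 0)" using Suc by simp
  ultimately show ?case by (intro Loop_step[of "S (Suc n)" r c "S n" "S 0"]) auto
qed

lemma exec_clear: "exec (Loop r Skip) s (s(r := 0))"
proof -
  have "exec (Loop r Skip) (s(r := s r)) (s(r := 0))"
    by (rule exec_Loop_iter[where S = "\<lambda>k. s(r := k)"]) (auto intro: Skip)
  then show ?thesis by simp
qed

lemma exec_move:
  assumes "a \<noteq> b"
  shows "exec (Loop a (Inc b)) s (s(a := 0, b := s b + s a))"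
proof -
  let ?S = "\<lambda>k. s(a := k, b := s b + (s a - k))"
  have "exec (Inc b) ((?S (Suc k))(a := k)) (?S k)" if "k < s a" for k
  proof -
    have "?S k = ((?S (Suc k))(a := k))(b := Suc (((?S (Suc k))(a := k)) b))"
      using that assms by (auto simp: fun_eq_iff)
    then show ?thesis using exec.Inc by metis
  qed
  then have "exec (Loop a (Inc b)) (?S (s a)) (?S 0)"
    using assms by (intro exec_Loop_iter[where S = ?S]) auto
  moreover have "?S (s a) = s" by auto
  ultimately show ?thesis by simp
qed

text \<open>A loop consumes its counter, so the value is sent to two registers and then restored
  from one of them.\<close>

lemma exec_copy:
  assumes "a \<noteq> b" "a \<noteq> t" "b \<noteq> t" "s t = 0"
  shows "exec (Seq (Loop a (Seq (Inc b) (Inc t))) (Loop t (Inc a))) s (s(b := s b + s a))"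
proof (rule exec.Seq)
  let ?S = "\<lambda>k. s(a := k, b := s b + (s a - k), t := s a - k)"
  have "exec (Seq (Inc b) (Inc t)) ((?S (Suc k))(a := k)) (?S k)" if "k < s a" for k
  proof (rule exec.Seq)
    let ?s = "(?S (Suc k))(a := k)"
    show "exec (Inc b) ?s (?s(b := Suc (?s b)))" by (rule exec.Inc)
    have "?S k = (?s(b := Suc (?s b)))(t := Suc ((?s(b := Suc (?s b))) t))"
      using that assms by (auto simp: fun_eq_iff)
    then show "exec (Inc t) (?s(b := Suc (?s b))) (?S k)" using exec.Inc by metis
  qed
  then have "exec (Loop a (Seq (Inc b) (Inc t))) (?S (s a)) (?S 0)"
    using assms by (intro exec_Loop_iter[where S = ?S]) auto
  moreover have "?S (s a) = s" using assms by auto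
  ultimately show "exec (Loop a (Seq (Inc b) (Inc t))) s (?S 0)" by simp
  have "(?S 0)(t := 0, a := ?S 0 a + ?S 0 t) = s(b := s b + s a)"
    using assms by (auto simp: fun_eq_iff)
  then show "exec (Loop t (Inc a)) (?S 0) (s(b := s b + s a))"
    using exec_move[of t a "?S 0"] assms by simp
qed

lemma exec_Seq_eq: "exec c s s' \<Longrightarrow> exec d s' s'' \<Longrightarrow> s'' = t \<Longrightarrow> exec (Seq c d) s t"
  using exec.Seq by blast

section \<open>Computable functions of an environment\<close>

text \<open>
  \<open>f\<close> takes the values of the variables, numbered in de Bruijn style. For every placement \<open>\<rho>\<close> of
  the variables into registers below \<open>d\<close>, there is a program that stores the value of \<open>f\<close> in
  register \<open>d\<close>, using the registers above \<open>d\<close> as scratch space. Quantifying over \<open>\<rho>\<close> makes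
  binding and renaming of variables free.
\<close>

definition cf_prog :: "nat \<Rightarrow> (nat \<Rightarrow> nat) \<Rightarrow> nat \<Rightarrow> ((nat \<Rightarrow> nat) \<Rightarrow> nat) \<Rightarrow> com \<Rightarrow> bool" where
  "cf_prog n \<rho> d f c \<longleftrightarrow>
     (\<forall>s e. (\<forall>i<n. s (\<rho> i) = e i) \<and> (\<forall>i\<ge>d. s i = 0) \<longrightarrow> exec c s (s(d := f e)))"

definition cf :: "((nat \<Rightarrow> nat) \<Rightarrow> nat) \<Rightarrow> bool" where
  "cf f \<longleftrightarrow> (\<exists>n. \<forall>\<rho> d. (\<forall>i<n. \<rho> i < d) \<longrightarrow> (\<exists>c. cf_prog n \<rho> d f c))"

lemma cf_progD:
  "cf_prog n \<rho> d f c \<Longrightarrow> (\<And>i. i < n \<Longrightarrow> s (\<rho> i) = e i) \<Longrightarrow> (\<And>i. i \<ge> d \<Longrightarrow> s i = 0) \<Longrightarrow>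
    exec c s (s(d := f e))"
  unfolding cf_prog_def by blast

lemma cfI:
  assumes "\<And>\<rho> d. (\<And>i. i < n \<Longrightarrow> \<rho> i < d) \<Longrightarrow> \<exists>c. cf_prog n \<rho> d f c"
  shows "cf f"
  unfolding cf_def using assms by blast

lemma cfE:
  assumes "cf f"
  obtains n where "\<And>m \<rho> d. n \<le> m \<Longrightarrow> (\<And>i. i < m \<Longrightarrow> \<rho> i < d) \<Longrightarrow> \<exists>c. cf_prog m \<rho> d f c"
proof -
  obtain n where n: "\<And>\<rho> d. (\<forall>i<n. \<rho> i < d) \<Longrightarrow> \<exists>c. cf_prog n \<rho> d f c"
    using assms unfolding cf_def by blast
  have "\<exists>c. cf_prog m \<rho> d f c" if m: "n \<le> m" and r: "\<And>i. i < m \<Longrightarrow> \<rho> i < d" for m \<rho> d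
  proof -
    have "\<forall>i<n. \<rho> i < d" using m r by (meson less_le_trans)
    then obtain c where "cf_prog n \<rho> d f c" using n by blast
    then have "cf_prog m \<rho> d f c" using m unfolding cf_prog_def by (meson less_le_trans)
    then show ?thesis by blast
  qed
  then show ?thesis using that by blast
qed

lemma cf_var: "cf (\<lambda>e. e i)"
proof (rule cfI[of "Suc i"])
  fix \<rho> :: "nat \<Rightarrow> nat" and d assume r: "\<And>j. j < Suc i \<Longrightarrow> \<rho> j < d"
  let ?c = "Seq (Loop (\<rho> i) (Seq (Inc d) (Inc (Suc d)))) (Loop (Suc d) (Inc (\<rho> i)))"
  have "exec ?c s (s(d := e i))" if "\<forall>j<Suc i. s (\<rho> j) = e j" "\<forall>j\<ge>d. s j = 0" for s e
    using exec_copy[of "\<rho> i" d "Suc d" s] that r[of i] by auto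
  then show "\<exists>c. cf_prog (Suc i) \<rho> d (\<lambda>e. e i) c" unfolding cf_prog_def by blast
qed

lemma cf_zero: "cf (\<lambda>e. 0)"
proof (rule cfI[of 0])
  fix \<rho> :: "nat \<Rightarrow> nat" and d
  have "exec Skip s (s(d := 0))" if "\<forall>i\<ge>d. s i = 0" for s
    using that exec.Skip[of s] by (metis fun_upd_triv le_refl)
  then show "\<exists>c. cf_prog 0 \<rho> d (\<lambda>e. 0) c" unfolding cf_prog_def by blast
qed

lemma cf_Suc:
  assumes "cf f"
  shows "cf (\<lambda>e. Suc (f e))"
proof -
  obtain n where n: "\<And>m \<rho> d. n \<le> m \<Longrightarrow> (\<And>i. i < m \<Longrightarrow> \<rho> i < d) \<Longrightarrow> \<exists>c. cf_prog m \<rho> d f c"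
    using cfE[OF assms] by blast
  show ?thesis
  proof (rule cfI[of n])
    fix \<rho> :: "nat \<Rightarrow> nat" and d assume "\<And>j. j < n \<Longrightarrow> \<rho> j < d"
    then obtain c where c: "cf_prog n \<rho> d f c" using n by blast
    have "cf_prog n \<rho> d (\<lambda>e. Suc (f e)) (Seq c (Inc d))"
      unfolding cf_prog_def
    proof (intro allI impI, elim conjE)
      fix s e :: "nat \<Rightarrow> nat" assume "\<forall>i<n. s (\<rho> i) = e i" "\<forall>i\<ge>d. s i = 0"
      then have "exec c s (s(d := f e))" using cf_progD[OF c] by blast
      from exec_Seq_eq[OF this exec.Inc[of d]] show "exec (Seq c (Inc d)) s (s(d := Suc (f e)))"
        by simp
    qed
    then show "\<exists>c. cf_prog n \<rho> d (\<lambda>e. Suc (f e)) c" by blast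
  qed
qed

lemma cf_const: "cf (\<lambda>e. k)"
  by (induction k) (auto intro: cf_zero cf_Suc)

text \<open>Renaming costs no code: the program is the one for the placement composed with
  \<open>\<pi>\<close>.\<close>

lemma cf_rename:
  assumes "cf f"
  shows "cf (\<lambda>e. f (\<lambda>i. e (\<pi> i)))"
proof -
  obtain n where n: "\<And>m \<rho> d. n \<le> m \<Longrightarrow> (\<And>i. i < m \<Longrightarrow> \<rho> i < d) \<Longrightarrow> \<exists>c. cf_prog m \<rho> d f c"
    using cfE[OF assms] by blast
  define N where "N = Suc (\<Sum>i<n. \<pi> i)"
  have N: "\<pi> i < N" if "i < n" for i
    using that by (auto simp: N_def less_Suc_eq_le intro!: member_le_sum)
  show ?thesis
  proof (rule cfI[of N])
    fix \<rho> :: "nat \<Rightarrow> nat" and d assume r: "\<And>j. j < N \<Longrightarrow> \<rho> j < d"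
    have "\<exists>c. cf_prog n (\<lambda>i. \<rho> (\<pi> i)) d f c"
      by (rule n) (auto intro: r N)
    then obtain c where "cf_prog n (\<lambda>i. \<rho> (\<pi> i)) d f c" by blast
    then have "cf_prog N \<rho> d (\<lambda>e. f (\<lambda>i. e (\<pi> i))) c"
      using N by (simp add: cf_prog_def)
    then show "\<exists>c. cf_prog N \<rho> d (\<lambda>e. f (\<lambda>i. e (\<pi> i))) c" by blast
  qed
qed

text \<open>The registers form a stack: the value of \<open>a\<close> stays in register
  \<open>d\<close> as the new variable \<open>0\<close> while \<open>h\<close> is evaluated into
  \<open>Suc d\<close>; the result is then moved down onto it.\<close>

lemma cf_let:
  assumes "cf a" and "cf (\<lambda>e. h (e 0) (\<lambda>i. e (Suc i)))"
  shows "cf (\<lambda>e. h (a e) e)"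
proof -
  let ?H = "\<lambda>e. h (e 0) (\<lambda>i. e (Suc i))"
  obtain n1 where n1: "\<And>m \<rho> d. n1 \<le> m \<Longrightarrow> (\<And>i. i < m \<Longrightarrow> \<rho> i < d) \<Longrightarrow> \<exists>c. cf_prog m \<rho> d a c"
    using cfE[OF assms(1)] by blast
  obtain n2 where n2: "\<And>m \<rho> d. n2 \<le> m \<Longrightarrow> (\<And>i. i < m \<Longrightarrow> \<rho> i < d) \<Longrightarrow> \<exists>c. cf_prog m \<rho> d ?H c"
    using cfE[OF assms(2)] by blast
  define n where "n = max n1 n2"
  have le: "n1 \<le> n" "n2 \<le> n" by (auto simp: n_def)
  show ?thesis
  proof (rule cfI[of n])
    fix \<rho> :: "nat \<Rightarrow> nat" and d assume r: "\<And>j. j < n \<Longrightarrow> \<rho> j < d"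
    obtain c1 where c1: "cf_prog n \<rho> d a c1" using n1[of n \<rho> d] r by (auto simp: le)
    define \<rho>' where "\<rho>' i = (case i of 0 \<Rightarrow> d | Suc i \<Rightarrow> \<rho> i)" for i
    have "\<rho>' i < Suc d" if "i < Suc n" for i
      using that r by (auto simp: \<rho>'_def split: nat.split intro: less_SucI)
    then obtain c2 where c2: "cf_prog (Suc n) \<rho>' (Suc d) ?H c2"
      using n2[of "Suc n" \<rho>' "Suc d"] le by auto
    let ?c = "Seq c1 (Seq c2 (Seq (Loop d Skip) (Loop (Suc d) (Inc d))))"
    have "exec ?c s (s(d := h (a e) e))"
      if s: "\<forall>i<n. s (\<rho> i) = e i" "\<forall>i\<ge>d. s i = 0" for s e
    proof -
      let ?s1 = "s(d := a e)" and ?s2 = "s(d := a e, Suc d := h (a e) e)"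
      have 1: "exec c1 s ?s1" using cf_progD[OF c1] s by blast
      let ?e = "\<lambda>i. case i of 0 \<Rightarrow> a e | Suc i \<Rightarrow> e i"
      have "?s1 (\<rho>' i) = ?e i" if "i < Suc n" for i
        using that s(1) r by (auto simp: \<rho>'_def split: nat.split)
      then have 2: "exec c2 ?s1 ?s2" using cf_progD[OF c2, of ?s1 ?e] s(2) by simp
      have 3: "exec (Loop d Skip) ?s2 (?s2(d := 0))" by (rule exec_clear)
      have 4: "(?s2(d := 0))(Suc d := 0, d := (?s2(d := 0)) d + (?s2(d := 0)) (Suc d)) = s(d := h (a e) e)"
        using s(2) by (auto simp: fun_eq_iff)
      show ?thesis
        using 1 2 3 exec_move[of "Suc d" d "?s2(d := 0)"] unfolding 4 by (auto intro!: exec.Seq)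
    qed
    then show "\<exists>c. cf_prog n \<rho> d (\<lambda>e. h (a e) e) c" unfolding cf_prog_def by blast
  qed
qed

text \<open>The loop counter falls whereas \<open>h\<close> expects a rising index, so both are
  kept: \<open>d\<close> is the accumulator, \<open>d+1\<close> the number of remaining rounds,
  \<open>d+2\<close> the index, and \<open>d+3\<close> receives the new value.\<close>

lemma cf_rec:
  assumes "cf b" and "cf g" and "cf (\<lambda>e. h (e 0) (e 1) (\<lambda>i. e (Suc (Suc i))))"
  shows "cf (\<lambda>e. rec_nat (g e) (\<lambda>i r. h i r e) (b e))"
proof -
  let ?H = "\<lambda>e. h (e 0) (e 1) (\<lambda>i. e (Suc (Suc i)))"
  obtain n1 where n1: "\<And>m \<rho> d. n1 \<le> m \<Longrightarrow> (\<And>i. i < m \<Longrightarrow> \<rho> i < d) \<Longrightarrow> \<exists>c. cf_prog m \<rho> d b c"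
    using cfE[OF assms(1)] by blast
  obtain n2 where n2: "\<And>m \<rho> d. n2 \<le> m \<Longrightarrow> (\<And>i. i < m \<Longrightarrow> \<rho> i < d) \<Longrightarrow> \<exists>c. cf_prog m \<rho> d g c"
    using cfE[OF assms(2)] by blast
  obtain n3 where n3: "\<And>m \<rho> d. n3 \<le> m \<Longrightarrow> (\<And>i. i < m \<Longrightarrow> \<rho> i < d) \<Longrightarrow> \<exists>c. cf_prog m \<rho> d ?H c"
    using cfE[OF assms(3)] by blast
  define n where "n = max n1 (max n2 n3)"
  have le: "n1 \<le> n" "n2 \<le> n" "n3 \<le> n" by (auto simp: n_def)
  show ?thesis
  proof (rule cfI[of n])
    fix \<rho> :: "nat \<Rightarrow> nat" and d assume r: "\<And>j. j < n \<Longrightarrow> \<rho> j < d"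
    obtain c1 where c1: "cf_prog n \<rho> d g c1" using n2[of n \<rho> d] r by (auto simp: le)
    obtain c2 where c2: "cf_prog n \<rho> (d+1) b c2"
      using n1[of n \<rho> "d+1"] r by (auto simp: le intro: less_SucI)
    define \<rho>' where "\<rho>' i = (case i of 0 \<Rightarrow> d+2 | Suc 0 \<Rightarrow> d | Suc (Suc i) \<Rightarrow> \<rho> i)" for i
    have "\<rho>' i < d+3" if "i < n+2" for i
      using that r[of "i-2"] by (auto simp: \<rho>'_def split: nat.split)
    then obtain c3 where c3: "cf_prog (n+2) \<rho>' (d+3) ?H c3"
      using n3[of "n+2" \<rho>' "d+3"] le by auto
    let ?body = "Seq c3 (Seq (Loop d Skip) (Seq (Loop (d+3) (Inc d)) (Inc (d+2))))"
    let ?c = "Seq c1 (Seq c2 (Seq (Loop (d+1) ?body) (Loop (d+2) Skip)))"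
    have "exec ?c s (s(d := rec_nat (g e) (\<lambda>i r. h i r e) (b e)))"
      if s: "\<forall>i<n. s (\<rho> i) = e i" "\<forall>i\<ge>d. s i = 0" for s e
    proof -
      let ?R = "rec_nat (g e) (\<lambda>i r. h i r e)"
      let ?S = "\<lambda>k. s(d := ?R (b e - k), d+1 := k, d+2 := b e - k)"
      let ?s1 = "s(d := g e)" and ?s2 = "s(d := g e, d+1 := b e)"
      have 1: "exec c1 s ?s1" using cf_progD[OF c1] s by blast
      have "?s1 (\<rho> i) = e i" if "i < n" for i
        using that s(1) r[of i] by auto
      then have 2: "exec c2 ?s1 ?s2" using cf_progD[OF c2, of ?s1 e] s(2) by simp
      have S: "?s2 = ?S (b e)" using s(2) by (auto simp: fun_eq_iff)
      have "exec ?body ((?S (Suc k))(d+1 := k)) (?S k)" if k: "k < b e" for k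
      proof -
        let ?i = "b e - Suc k"
        let ?t = "(?S (Suc k))(d+1 := k)" and ?e = "\<lambda>i. case i of 0 \<Rightarrow> ?i | Suc 0 \<Rightarrow> ?R ?i | Suc (Suc i) \<Rightarrow> e i"
        let ?v = "h ?i (?R ?i) e"
        have "?t (\<rho>' i) = ?e i" if "i < n + 2" for i
          using that s(1) r[of "i-2"] by (auto simp: \<rho>'_def split: nat.split)
        then have 1: "exec c3 ?t (?t(d+3 := ?v))" using cf_progD[OF c3, of ?t ?e] s(2) by simp
        let ?t1 = "?t(d+3 := ?v)"
        have 2: "exec (Loop d Skip) ?t1 (?t1(d := 0))" by (rule exec_clear)
        let ?t2 = "?t1(d := 0)"
        have 3: "exec (Loop (d+3) (Inc d)) ?t2 (?t2(d+3 := 0, d := ?t2 d + ?t2 (d+3)))"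
          by (rule exec_move) simp
        let ?t3 = "?t2(d+3 := 0, d := ?t2 d + ?t2 (d+3))"
        have "b e - k = Suc ?i" using k by simp
        then have 4: "?t3(d+2 := Suc (?t3 (d+2))) = ?S k"
          using s(2) by (auto simp: fun_eq_iff)
        have "exec (Inc (d+2)) ?t3 (?t3(d+2 := Suc (?t3 (d+2))))" by (rule exec.Inc)
        then have "exec (Inc (d+2)) ?t3 (?S k)" unfolding 4 .
        with 1 2 3 show ?thesis by (blast intro: exec.Seq)
      qed
      then have "exec (Loop (d+1) ?body) (?S (b e)) (?S 0)"
        by (intro exec_Loop_iter[where S = ?S]) auto
      then have 3: "exec (Loop (d+1) ?body) ?s2 (?S 0)" unfolding S .
      have "(?S 0)(d+2 := 0) = s(d := ?R (b e))" using s(2) by (auto simp: fun_eq_iff)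
      then have 4: "exec (Loop (d+2) Skip) (?S 0) (s(d := ?R (b e)))"
        using exec_clear[of "d+2" "?S 0"] by simp
      show ?thesis using 1 2 3 4 by (blast intro: exec.Seq)
    qed
    then show "\<exists>c. cf_prog n \<rho> d (\<lambda>e. rec_nat (g e) (\<lambda>i r. h i r e) (b e)) c"
      unfolding cf_prog_def by blast
  qed
qed

text \<open>Register \<open>d\<close> holds the candidate and \<open>Suc d\<close> the value of
  \<open>h\<close> there, which serves as the loop condition.\<close>

lemma cf_Least:
  assumes "cf (\<lambda>e. h (e 0) (\<lambda>i. e (Suc i)))" and ex: "\<And>e. \<exists>i. h i e = 0"
  shows "cf (\<lambda>e. LEAST i. h i e = 0)"
proof -
  let ?H = "\<lambda>e. h (e 0) (\<lambda>i. e (Suc i))"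
  obtain n where n: "\<And>m \<rho> d. n \<le> m \<Longrightarrow> (\<And>i. i < m \<Longrightarrow> \<rho> i < d) \<Longrightarrow> \<exists>c. cf_prog m \<rho> d ?H c"
    using cfE[OF assms(1)] by blast
  show ?thesis
  proof (rule cfI[of n])
    fix \<rho> :: "nat \<Rightarrow> nat" and d assume r: "\<And>j. j < n \<Longrightarrow> \<rho> j < d"
    define \<rho>' where "\<rho>' i = (case i of 0 \<Rightarrow> d | Suc i \<Rightarrow> \<rho> i)" for i
    have "\<rho>' i < Suc d" if "i < Suc n" for i
      using that r by (auto simp: \<rho>'_def split: nat.split intro: less_SucI)
    then obtain c where c: "cf_prog (Suc n) \<rho>' (Suc d) ?H c"
      using n[of "Suc n" \<rho>' "Suc d"] by auto
    let ?body = "Seq (Loop (Suc d) Skip) (Seq (Inc d) c)"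
    let ?c = "Seq c (Loop (Suc d) ?body)"
    have "exec ?c s (s(d := LEAST i. h i e = 0))"
      if s: "\<forall>i<n. s (\<rho> i) = e i" "\<forall>i\<ge>d. s i = 0" for s e
    proof -
      define L where "L = (LEAST i. h i e = 0)"
      have L: "h L e = 0" unfolding L_def using ex by (rule LeastI_ex)
      let ?S = "\<lambda>j. s(d := j, Suc d := h j e)"
      have c': "exec c (s(d := j)) (?S j)" for j
      proof -
        let ?e = "\<lambda>i. case i of 0 \<Rightarrow> j | Suc i \<Rightarrow> e i"
        have "(s(d := j)) (\<rho>' i) = ?e i" if "i < Suc n" for i
          using that s(1) r by (auto simp: \<rho>'_def split: nat.split)
        then show ?thesis using cf_progD[OF c, of "s(d := j)" ?e] s(2) by simp
      qed
      \<comment> \<open>The induction runs backwards from the least zero \<open>L\<close>, since the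
        derivation of a loop is built from its last test.\<close>
      have "exec (Loop (Suc d) ?body) (?S j) (s(d := L))" if "j \<le> L" for j
        using that
      proof (induction rule: inc_induct)
        case base
        have eq: "?S L = s(d := L)" using L s(2) by (auto simp: fun_eq_iff)
        have "?S L (Suc d) = 0" using L by simp
        then have "exec (Loop (Suc d) ?body) (?S L) (?S L)" by (rule exec.Loop_end)
        then show ?case by (simp only: eq)
      next
        case (step j)
        have nz: "?S j (Suc d) \<noteq> 0" using not_less_Least[of j "\<lambda>i. h i e = 0"] step(2) by (simp add: L_def)
        let ?t = "(?S j)(Suc d := ?S j (Suc d) - 1)"
        have "?t(Suc d := 0) = s(d := j)" using s(2) by (auto simp: fun_eq_iff)
        then have 1: "exec (Loop (Suc d) Skip) ?t (s(d := j))"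
          using exec_clear[of "Suc d" ?t] by simp
        have 2: "exec (Inc d) (s(d := j)) (s(d := Suc j))" using exec.Inc[of d "s(d := j)"] by simp
        have "exec ?body ?t (?S (Suc j))" using 1 2 c'[of "Suc j"] by (blast intro: exec.Seq)
        then show ?case using exec.Loop_step[of "?S j" "Suc d" ?body "?S (Suc j)", OF nz] step.IH by blast
      qed
      then have "exec (Loop (Suc d) ?body) (?S 0) (s(d := L))" by simp
      moreover have "s(d := 0) = s" using s(2) by (auto simp: fun_eq_iff)
      then have "exec c s (?S 0)" using c'[of 0] by simp
      ultimately show ?thesis unfolding L_def by (blast intro: exec.Seq)
    qed
    then show "\<exists>c. cf_prog n \<rho> d (\<lambda>e. LEAST i. h i e = 0) c" unfolding cf_prog_def by blast
  qed
qed

lemma cf_computes: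
  assumes "cf (\<lambda>e. F (map e [0..<m]))" and "0 < m"
  shows "\<exists>M. tm_wf M \<and> computes M m F"
proof -
  obtain n where n: "\<And>m' \<rho> d. n \<le> m' \<Longrightarrow> (\<And>i. i < m' \<Longrightarrow> \<rho> i < d) \<Longrightarrow> \<exists>c. cf_prog m' \<rho> d (\<lambda>e. F (map e [0..<m])) c"
    using cfE[OF assms(1)] by blast
  \<comment> \<open>Variables beyond the \<open>m\<close> arguments do not influence the value and
    are placed in register \<open>0\<close>, which lies below the output register \<open>m\<close>
    because \<open>0 < m\<close>.\<close>
  define \<rho> where "\<rho> i = (if i < m then i else 0)" for i
  have r: "\<rho> i < m" for i using assms(2) by (simp add: \<rho>_def)
  obtain c where c: "cf_prog n \<rho> m (\<lambda>e. F (map e [0..<m])) c"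
    using n[of n \<rho> m] r by blast
  have "exec c (regs xs) ((regs xs)(m := F xs))" if xs: "length xs = m" for xs
  proof -
    have "map (\<lambda>i. regs xs (\<rho> i)) [0..<m] = xs"
      using xs by (intro nth_equalityI) (auto simp: regs_def \<rho>_def)
    then show ?thesis
      using cf_progD[OF c, of "regs xs" "\<lambda>i. regs xs (\<rho> i)"] xs by (auto simp: regs_def)
  qed
  then show ?thesis by (intro exec_computes[of m c F]) (metis fun_upd_same)
qed

lemma cf_recursive1: "cf (\<lambda>e. f (e 0)) \<Longrightarrow> recursive1 f"
  unfolding recursive1_def by (rule cf_computes) simp_all

lemma cf_recursive2: "cf (\<lambda>e. f (e 0) (e 1)) \<Longrightarrow> recursive2 f"
  unfolding recursive2_def by (rule cf_computes) (simp_all add: numeral_2_eq_2)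

section \<open>Arithmetic, predicates and bounded quantifiers\<close>

definition cfp :: "((nat \<Rightarrow> nat) \<Rightarrow> bool) \<Rightarrow> bool" where
  "cfp P \<longleftrightarrow> cf (\<lambda>e. if P e then 1 else 0)"

lemma cf_shift: "cf a \<Longrightarrow> cf (\<lambda>e. a (\<lambda>i. e (Suc i)))"
  by (rule cf_rename)

lemma cf_app1:
  assumes "cf (\<lambda>e. f (e 0))" and "cf a"
  shows "cf (\<lambda>e. f (a e))"
  using cf_let[of a "\<lambda>x e. f x"] assms by simp

lemma cf_app2:
  assumes "cf (\<lambda>e. f (e 0) (e 1))" and "cf a" and "cf b"
  shows "cf (\<lambda>e. f (a e) (b e))"
proof (rule cf_let[OF assms(2), of "\<lambda>x e. f x (b e)"])
  have "cf (\<lambda>e. f (e 1) (e 0))"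
    using cf_rename[OF assms(1), of "\<lambda>i. if i = 0 then 1 else 0"] by simp
  then show "cf (\<lambda>e. f (e 0) (b (\<lambda>i. e (Suc i))))"
    using cf_let[OF cf_shift[OF assms(3)], of "\<lambda>y e. f (e 0) y"] by simp
qed

lemma cf_plus: assumes "cf a" "cf b" shows "cf (\<lambda>e. a e + b e)"
proof (rule cf_app2[OF _ assms])
  have "rec_nat x (\<lambda>i r. Suc r) y = x + y" for x y :: nat by (induction y) auto
  with cf_rec[of "\<lambda>e. e 1" "\<lambda>e. e 0" "\<lambda>i r e. Suc r"] show "cf (\<lambda>e. e 0 + e 1)"
    by (simp add: cf_var cf_Suc)
qed

lemma cf_mult: assumes "cf a" "cf b" shows "cf (\<lambda>e. a e * b e)"
proof (rule cf_app2[OF _ assms])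
  have "rec_nat 0 (\<lambda>i r. r + x) y = x * y" for x y :: nat by (induction y) auto
  with cf_rec[of "\<lambda>e. e 1" "\<lambda>e. 0" "\<lambda>i r e. r + e 0"] show "cf (\<lambda>e. e 0 * e 1)"
    by (simp add: cf_var cf_zero cf_plus)
qed

lemma cf_diff: assumes "cf a" "cf b" shows "cf (\<lambda>e. a e - b e)"
proof -
  \<comment> \<open>The index of the last round is the predecessor; for \<open>0\<close> there is no
    round and the initial value \<open>0\<close> remains.\<close>
  have "rec_nat 0 (\<lambda>i r. i) y = y - 1" for y :: nat by (cases y) auto
  with cf_rec[of "\<lambda>e. e 0" "\<lambda>e. 0" "\<lambda>i r e. i"] have pred: "cf (\<lambda>e. e 0 - 1)"
    by (simp add: cf_var cf_zero)
  have "rec_nat x (\<lambda>i r. r - 1) y = x - y" for x y :: nat by (induction y) auto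
  with cf_rec[of "\<lambda>e. e 1" "\<lambda>e. e 0" "\<lambda>i r e. r - 1"] have "cf (\<lambda>e. e 0 - e 1)"
    using cf_app1[OF pred, of "\<lambda>e. e 1"] by (simp add: cf_var)
  then show ?thesis using cf_app2[of "(-)"] assms by blast
qed

lemma cf_power: assumes "cf a" "cf b" shows "cf (\<lambda>e. a e ^ b e)"
proof (rule cf_app2[OF _ assms])
  have "rec_nat 1 (\<lambda>i r. r * x) y = x ^ y" for x y :: nat by (induction y) auto
  with cf_rec[of "\<lambda>e. e 1" "\<lambda>e. 1" "\<lambda>i r e. r * e 0"] show "cf (\<lambda>e. e 0 ^ e 1)"
    by (simp add: cf_var cf_const cf_mult)
qed

lemma cfp_less: assumes "cf a" "cf b" shows "cfp (\<lambda>e. a e < b e)"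
proof -
  have "(if x < y then 1 else 0) = 1 - (1 - (y - x))" for x y :: nat by auto
  then show ?thesis unfolding cfp_def using assms by (auto intro!: cf_diff cf_const)
qed

lemma cfp_le: assumes "cf a" "cf b" shows "cfp (\<lambda>e. a e \<le> b e)"
proof -
  have "(if x \<le> y then 1 else 0) = 1 - (x - y)" for x y :: nat by auto
  then show ?thesis unfolding cfp_def using assms by (auto intro!: cf_diff cf_const)
qed

lemma cfp_conj: assumes "cfp P" "cfp Q" shows "cfp (\<lambda>e. P e \<and> Q e)"
proof -
  have "(if p \<and> q then 1 else 0) = (if p then 1 else 0) * (if q then 1 else (0::nat))" for p q by auto
  then show ?thesis using assms unfolding cfp_def by (simp only: cf_mult)
qed

lemma cfp_not: assumes "cfp P" shows "cfp (\<lambda>e. \<not> P e)"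
proof -
  have "(if \<not> p then 1 else 0) = 1 - (if p then 1 else (0::nat))" for p by auto
  then show ?thesis using assms unfolding cfp_def by (simp only: cf_diff cf_const)
qed

lemma cfp_disj: assumes "cfp P" "cfp Q" shows "cfp (\<lambda>e. P e \<or> Q e)"
  using cfp_not[OF cfp_conj[OF cfp_not[OF assms(1)] cfp_not[OF assms(2)]]] by simp

lemma cfp_eq: assumes "cf a" "cf b" shows "cfp (\<lambda>e. a e = b e)"
  using cfp_conj[OF cfp_le[OF assms] cfp_le[OF assms(2,1)]] by (simp add: order_eq_iff)

lemma cf_if: assumes "cfp P" "cf a" "cf b" shows "cf (\<lambda>e. if P e then a e else b e)"
proof -
  have "(if P e then a e else b e) = (if P e then 1 else 0) * a e + (1 - (if P e then 1 else 0)) * b e"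
    for e by simp
  moreover have "cf (\<lambda>e. (if P e then 1 else 0) * a e + (1 - (if P e then 1 else 0)) * b e)"
    by (intro cf_plus cf_mult cf_diff cf_const assms assms(1)[unfolded cfp_def])
  ultimately show ?thesis by presburger
qed

lemma cfp_all:
  assumes "cf b" and "cfp (\<lambda>e. P (e 0) (\<lambda>i. e (Suc i)))"
  shows "cfp (\<lambda>e. \<forall>i<b e. P i e)"
proof -
  have "rec_nat 1 (\<lambda>i r. if P i e then r else 0) n = (if \<forall>i<n. P i e then 1 else (0::nat))" for n e
    by (induction n) (auto simp: less_Suc_eq)
  \<comment> \<open>Inside the recursion, variable \<open>1\<close> is the accumulator, which
    \<open>P\<close> has to skip.\<close>
  moreover have "cfp (\<lambda>e. P (e 0) (\<lambda>i. e (Suc (Suc i))))"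
    using cf_rename[OF assms(2)[unfolded cfp_def], of "\<lambda>i. case i of 0 \<Rightarrow> 0 | Suc i \<Rightarrow> Suc (Suc i)"]
    by (simp add: cfp_def)
  then have "cf (\<lambda>e. rec_nat 1 (\<lambda>i r. if P i e then r else 0) (b e))"
    by (intro cf_rec assms cf_const cf_if) (auto intro: cf_var cf_const)
  ultimately show ?thesis by (simp only: cfp_def)
qed

lemma cfp_ex:
  assumes "cf b" and "cfp (\<lambda>e. P (e 0) (\<lambda>i. e (Suc i)))"
  shows "cfp (\<lambda>e. \<exists>i<b e. P i e)"
proof -
  have "cfp (\<lambda>e. \<not> (\<forall>i<b e. \<not> P i e))" by (intro cfp_not cfp_all assms)
  then show ?thesis by simp
qed

lemma cf_LEAST:
  assumes "cfp (\<lambda>e. P (e 0) (\<lambda>i. e (Suc i)))" and "\<And>e. \<exists>i. P i e"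
  shows "cf (\<lambda>e. LEAST i. P i e)"
proof -
  have eq: "(if \<not> P i e then 1 else 0) = (0::nat) \<longleftrightarrow> P i e" for i e by simp
  show ?thesis
    using cf_Least[of "\<lambda>i e. if \<not> P i e then 1 else 0"] cfp_not[OF assms(1)] assms(2)
    unfolding eq cfp_def by blast
qed

lemmas cf_intros = cf_var cf_Suc cf_const cf_plus cf_mult cf_diff cf_power cf_if
  cfp_less cfp_le cfp_eq cfp_conj cfp_disj cfp_not cfp_all cfp_ex

section \<open>Coding of finite sequences\<close>

definition hdn :: "nat \<Rightarrow> nat" where "hdn c = fst (prod_decode c)"
definition tln :: "nat \<Rightarrow> nat" where "tln c = snd (prod_decode c)"

lemma hdn_encode [simp]: "hdn (prod_encode (a, b)) = a"
  and tln_encode [simp]: "tln (prod_encode (a, b)) = b"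
  by (simp_all add: hdn_def tln_def)

lemma cf_prod_encode: assumes "cf a" "cf b" shows "cf (\<lambda>e. prod_encode (a e, b e))"
proof -
  have "rec_nat 0 (\<lambda>i r. r + Suc i) n = triangle n" for n by (induction n) auto
  with cf_rec[of "\<lambda>e. e 0" "\<lambda>e. 0" "\<lambda>i r e. r + Suc i"] have "cf (\<lambda>e. triangle (e 0))"
    by (simp add: cf_var cf_zero cf_plus cf_Suc)
  from cf_app1[OF this, of "\<lambda>e. a e + b e"] assms show ?thesis
    by (simp add: prod_encode_def cf_plus)
qed

lemma prod_encode_eq_iff: "prod_encode (a, b) = c \<longleftrightarrow> a = hdn c \<and> b = tln c"
  unfolding hdn_def tln_def by (metis prod.collapse prod_decode_inverse prod_encode_inverse fst_conv snd_conv)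

lemma tln_le: "tln c \<le> c"
  using le_prod_encode_2[of "tln c" "hdn c"] prod_encode_eq_iff[of "hdn c" "tln c" c] by simp

text \<open>Unpairing is done by searching for the pair, so only the pairing function is programmed.
  The search for the other component can be bounded because of \<open>tln_le\<close>.\<close>

lemma cf_hdn: assumes "cf a" shows "cf (\<lambda>e. hdn (a e))"
proof (rule cf_app1[OF _ assms])
  have "(\<exists>y<Suc c. prod_encode (x, y) = c) \<longleftrightarrow> x = hdn c" for x c
    using tln_le[of c] by (auto simp: prod_encode_eq_iff less_Suc_eq_le)
  then have "hdn c = (LEAST x. \<exists>y<Suc c. prod_encode (x, y) = c)" for c
    by (simp add: Least_equality)
  moreover have "cf (\<lambda>e. LEAST x. \<exists>y<Suc (e 0). prod_encode (x, y) = e 0)"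
  proof (rule cf_LEAST)
    show "cfp (\<lambda>e. \<exists>y<Suc (e (Suc 0)). prod_encode (e 0, y) = e (Suc 0))"
      by (intro cf_intros cf_prod_encode)
    show "\<exists>x y. y < Suc (e 0) \<and> prod_encode (x, y) = e 0" for e :: "nat \<Rightarrow> nat"
      using tln_le[of "e 0"] by (auto simp: prod_encode_eq_iff less_Suc_eq_le)
  qed
  ultimately show "cf (\<lambda>e. hdn (e 0))" by simp
qed

lemma cf_tln: assumes "cf a" shows "cf (\<lambda>e. tln (a e))"
proof (rule cf_app1[OF _ assms])
  have "tln c = (LEAST y. prod_encode (hdn c, y) = c)" for c
    by (simp add: Least_equality prod_encode_eq_iff)
  moreover have "cf (\<lambda>e. LEAST y. prod_encode (hdn (e 0), y) = e 0)"
  proof (rule cf_LEAST)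
    show "cfp (\<lambda>e. prod_encode (hdn (e (Suc 0)), e 0) = e (Suc 0))"
      by (intro cf_intros cf_prod_encode cf_hdn)
  qed (simp add: prod_encode_eq_iff)
  ultimately show "cf (\<lambda>e. tln (e 0))" by simp
qed

text \<open>A code is an infinite stream read by repeated unpairing, without length or end marker.
  Since \<open>0\<close> codes the pair of zeros, a tail \<open>0\<close> continues a list with
  zeros, which later stand for blank tapes.\<close>

definition dec :: "nat \<Rightarrow> nat \<Rightarrow> nat" where
  "dec c i = hdn (rec_nat c (\<lambda>j r. tln r) i)"

lemma cf_dec: assumes "cf a" "cf b" shows "cf (\<lambda>e. dec (a e) (b e))"
  unfolding dec_def by (intro cf_hdn cf_rec[where h = "\<lambda>i r e. tln r"] assms cf_tln cf_var)

lemma dec_0: "dec c 0 = hdn c"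
  by (simp add: dec_def)

lemma dec_Suc: "dec c (Suc i) = dec (tln c) i"
proof -
  have "rec_nat c (\<lambda>j r. tln r) (Suc i) = rec_nat (tln c) (\<lambda>j r. tln r) i"
    by (induction i) auto
  then show ?thesis by (simp add: dec_def)
qed

lemma dec_zero [simp]: "dec 0 i = 0"
proof -
  have "prod_encode (0, 0) = 0" by (simp add: prod_encode_def)
  then have "hdn 0 = 0" "tln 0 = 0"
    using hdn_encode[of 0 0] tln_encode[of 0 0] by simp_all
  then show ?thesis by (induction i) (simp_all add: dec_0 dec_Suc)
qed

lemma ex_dec: "\<exists>c. \<forall>i<n. dec c i = f i"
proof (induction n arbitrary: f)
  case (Suc n)
  obtain c where c: "\<forall>i<n. dec c i = f (Suc i)" using Suc[of "\<lambda>i. f (Suc i)"] by blast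
  have "dec (prod_encode (f 0, c)) i = f i" if "i < Suc n" for i
    using that c by (cases i) (auto simp: dec_0 dec_Suc)
  then show ?case by blast
qed auto

section \<open>A universal halting predicate\<close>

text \<open>
  A machine code \<open>e\<close> consists of the number \<open>dec e 0\<close> of tapes, the number \<open>dec e 1\<close> of entries of
  the transition table, and the table \<open>dec e 2\<close>, whose entries are \<open>[q, syms, q', writes, moves]\<close>
  with moves \<open>0, 1, 2\<close> for \<open>-1, 0, 1\<close>. A configuration is coded by \<open>[q, heads, tapes]\<close>, where
  position \<open>z\<close> of a tape stands for the cell \<open>z - L\<close>.
\<close>

definition table_entry :: "nat \<Rightarrow> nat \<Rightarrow> nat" where
  "table_entry e j = dec (dec e 2) j"

definition head_code :: "nat \<Rightarrow> nat \<Rightarrow> nat" where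
  "head_code C i = dec (dec C 1) i"

definition cell_code :: "nat \<Rightarrow> nat \<Rightarrow> nat \<Rightarrow> nat" where
  "cell_code C i z = dec (dec (dec C 2) i) z"

definition entry_matches :: "nat \<Rightarrow> nat \<Rightarrow> nat \<Rightarrow> bool" where
  "entry_matches K E C \<longleftrightarrow> dec E 0 = dec C 0 \<and>
     (\<forall>i<K. dec (dec E 1) i = cell_code C i (head_code C i))"

text \<open>The head equation uses \<open>Suc\<close> instead of a truncated subtraction, so a left
  move from position \<open>0\<close> has no successor rather than leaving the head in
  place.\<close>

definition step_code :: "nat \<Rightarrow> nat \<Rightarrow> nat \<Rightarrow> nat \<Rightarrow> bool" where
  "step_code e W C C' \<longleftrightarrow> (\<exists>j<dec e 1. entry_matches (dec e 0) (table_entry e j) C \<and>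
     dec C' 0 = dec (table_entry e j) 2 \<and>
     (\<forall>i<dec e 0. Suc (head_code C' i) = head_code C i + dec (dec (table_entry e j) 4) i \<and>
        (\<forall>z<W. cell_code C' i z =
           (if z = head_code C i then dec (dec (table_entry e j) 3) i else cell_code C i z))))"

definition halt_code :: "nat \<Rightarrow> nat \<Rightarrow> bool" where
  "halt_code e C \<longleftrightarrow> \<not> (\<exists>j<dec e 1. entry_matches (dec e 0) (table_entry e j) C)"

definition init_code :: "nat \<Rightarrow> nat \<Rightarrow> nat \<Rightarrow> nat \<Rightarrow> nat \<Rightarrow> bool" where
  "init_code e X L W C \<longleftrightarrow> dec C 0 = 0 \<and> (\<forall>i<dec e 0. head_code C i = L \<and>
     (\<forall>z<W. cell_code C i z = (if L \<le> z \<and> z < L + dec X i then 1 else 0)))"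

text \<open>
  The history \<open>t\<close> shows that the machine \<open>e\<close>, started with \<open>dec X i\<close> on each tape \<open>i\<close>, halts with
  \<open>y\<close> on tape \<open>m\<close>. It consists of the number \<open>L\<close> of steps, the width \<open>W\<close> of the visible part
  of the tapes, and the list of the configurations.
\<close>

definition history :: "nat \<Rightarrow> nat \<Rightarrow> nat \<Rightarrow> nat \<Rightarrow> nat \<Rightarrow> bool" where
  "history e X m y t \<longleftrightarrow>
     2 * dec t 0 < dec t 1 \<and> dec t 0 + y < dec t 1 \<and>
     init_code e X (dec t 0) (dec t 1) (dec (dec t 2) 0) \<and>
     (\<forall>j<dec t 0. step_code e (dec t 1) (dec (dec t 2) j) (dec (dec t 2) (Suc j))) \<and>
     halt_code e (dec (dec t 2) (dec t 0)) \<and>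
     (\<forall>z<dec t 1. cell_code (dec (dec t 2) (dec t 0)) m z = (if dec t 0 \<le> z \<and> z < dec t 0 + y then 1 else 0))"

lemma cfp_history:
  assumes "cf a" "cf x" "cf m" "cf y" "cf t"
  shows "cfp (\<lambda>e. history (a e) (x e) (m e) (y e) (t e))"
proof -
  \<comment> \<open>At most four bounded quantifiers are nested (two from \<open>history\<close> and
    \<open>step_code\<close> over steps and table entries, then tape and cell); each shifts the
    parameters by one variable.\<close>
  note s1 = assms[THEN cf_shift]
  note s2 = s1[THEN cf_shift]
  note s3 = s2[THEN cf_shift]
  note s4 = s3[THEN cf_shift]
  show ?thesis
    unfolding history_def init_code_def step_code_def halt_code_def entry_matches_def
      table_entry_def head_code_def cell_code_def
    by (intro cf_intros cf_dec assms s1 s2 s3 s4)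
qed

text \<open>Several entries may match the same argument provided that all of them agree with
  \<open>delta\<close>; a missing entry means halting.\<close>

definition tm_code :: "nat \<Rightarrow> tm \<Rightarrow> bool" where
  "tm_code e M \<longleftrightarrow> dec e 0 = tapes M \<and>
     (\<forall>q syms. q < states M \<and> length syms = tapes M \<and> set syms \<subseteq> {..<symbols M} \<longrightarrow>
       (let J = {j. j < dec e 1 \<and> dec (table_entry e j) 0 = q \<and>
                  (\<forall>i<tapes M. dec (dec (table_entry e j) 1) i = syms ! i)} in
        case delta M q syms of None \<Rightarrow> J = {}
        | Some (q', acts) \<Rightarrow> J \<noteq> {} \<and> (\<forall>j\<in>J. dec (table_entry e j) 2 = q' \<and>
            (\<forall>i<tapes M. dec (dec (table_entry e j) 3) i = fst (acts ! i) \<and>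
               int (dec (dec (table_entry e j) 4) i) = snd (acts ! i) + 1))))"

lemma ex_tm_code:
  assumes "tm_wf M"
  shows "\<exists>e. tm_code e M"
proof -
  define S where "S = {(q, syms). q < states M \<and> set syms \<subseteq> {..<symbols M} \<and> length syms = tapes M \<and>
    delta M q syms \<noteq> None}"
  have "finite ({..<states M} \<times> {syms. set syms \<subseteq> {..<symbols M} \<and> length syms = tapes M})"
    by (intro finite_cartesian_product finite_lists_length_eq) auto
  then have "finite S" by (rule rev_finite_subset) (auto simp: S_def)
  then obtain l where l: "set l = S" using finite_list by blast
  have "\<exists>E. \<exists>q syms q' acts. l ! j = (q, syms) \<and> delta M q syms = Some (q', acts) \<and>
      dec E 0 = q \<and> (\<forall>i<tapes M. dec (dec E 1) i = syms ! i) \<and> dec E 2 = q' \<and>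
      (\<forall>i<tapes M. dec (dec E 3) i = fst (acts ! i) \<and> int (dec (dec E 4) i) = snd (acts ! i) + 1)"
    if "j < length l" for j
  proof -
    obtain q syms where lj: "l ! j = (q, syms)" by fastforce
    with that l have mem: "(q, syms) \<in> S" by (metis nth_mem)
    then obtain q' acts where d: "delta M q syms = Some (q', acts)" by (auto simp: S_def)
    have acts: "length acts = tapes M" "set acts \<subseteq> {..<symbols M} \<times> {-1, 0, 1}"
      using assms mem d unfolding tm_wf_def S_def by blast+
    obtain a where a: "\<forall>i<tapes M. dec a i = syms ! i" using ex_dec by blast
    obtain b where b: "\<forall>i<tapes M. dec b i = fst (acts ! i)" using ex_dec[of _ "\<lambda>i. fst (acts ! i)"] by blast
    obtain c where c: "\<forall>i<tapes M. dec c i = nat (snd (acts ! i) + 1)"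
      using ex_dec[of _ "\<lambda>i. nat (snd (acts ! i) + 1)"] by blast
    have mv: "snd (acts ! i) + 1 \<ge> 0" if "i < tapes M" for i
    proof -
      have "acts ! i \<in> {..<symbols M} \<times> {-1, 0, 1}" using acts that by (metis nth_mem subsetD)
      then show ?thesis by auto
    qed
    obtain E where E: "\<forall>i<5. dec E i = [q, a, q', b, c] ! i" using ex_dec[of 5 "\<lambda>i. [q, a, q', b, c] ! i"] by blast
    have "dec E 0 = q" "dec E 1 = a" "dec E 2 = q'" "dec E 3 = b" "dec E 4 = c"
      using E[rule_format, of 0] E[rule_format, of 1] E[rule_format, of 2] E[rule_format, of 3]
        E[rule_format, of 4] by (simp_all add: eval_nat_numeral)
    then show ?thesis using lj d a b c mv
      by - (rule exI[of _ E], rule exI[of _ q], rule exI[of _ syms], rule exI[of _ q'],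
          rule exI[of _ acts], simp)
  qed
  then obtain E where E: "\<And>j. j < length l \<Longrightarrow> \<exists>q syms q' acts. l ! j = (q, syms) \<and>
      delta M q syms = Some (q', acts) \<and>
      dec (E j) 0 = q \<and> (\<forall>i<tapes M. dec (dec (E j) 1) i = syms ! i) \<and> dec (E j) 2 = q' \<and>
      (\<forall>i<tapes M. dec (dec (E j) 3) i = fst (acts ! i) \<and>
         int (dec (dec (E j) 4) i) = snd (acts ! i) + 1)"
    by metis
  obtain D where D: "\<forall>j<length l. dec D j = E j" using ex_dec[of _ E] by blast
  obtain e where e: "\<forall>i<3. dec e i = [tapes M, length l, D] ! i"
    using ex_dec[of 3 "\<lambda>i. [tapes M, length l, D] ! i"] by blast
  have e': "dec e 0 = tapes M" "dec e 1 = length l" "dec e 2 = D"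
    using e[rule_format, of 0] e[rule_format, of 1] e[rule_format, of 2] by (simp_all add: eval_nat_numeral)
  have ent: "table_entry e j = E j" if "j < length l" for j
    using that D e' by (simp add: table_entry_def)
  have "tm_code e M"
    unfolding tm_code_def Let_def
  proof (intro conjI allI impI, goal_cases)
    case 1 show ?case by (rule e')
  next
    case (2 q syms)
    define J where "J = {j. j < dec e 1 \<and> dec (table_entry e j) 0 = q \<and>
                  (\<forall>i<tapes M. dec (dec (table_entry e j) 1) i = syms ! i)}"
    have J: "j < length l \<and> l ! j = (q, syms)" if "j \<in> J" for j
    proof -
      have j: "j < length l" using that by (simp add: J_def e'[unfolded One_nat_def])
      then obtain q1 syms1 where 1: "l ! j = (q1, syms1)" "dec (E j) 0 = q1"
          "\<forall>i<tapes M. dec (dec (E j) 1) i = syms1 ! i" using E by blast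
      have "(q1, syms1) \<in> S" using j 1 l by (metis nth_mem)
      then have "length syms1 = tapes M" by (simp add: S_def)
      moreover have "\<forall>i<tapes M. syms1 ! i = syms ! i" "q1 = q"
        using that 1 ent[OF j] by (auto simp: J_def)
      ultimately show ?thesis using 1 j 2 by (auto intro: nth_equalityI)
    qed
    have "case delta M q syms of None \<Rightarrow> J = {}
        | Some (q', acts) \<Rightarrow> J \<noteq> {} \<and> (\<forall>j\<in>J. dec (table_entry e j) 2 = q' \<and>
            (\<forall>i<tapes M. dec (dec (table_entry e j) 3) i = fst (acts ! i) \<and>
               int (dec (dec (table_entry e j) 4) i) = snd (acts ! i) + 1))"
    proof (cases "delta M q syms")
      case None
      have "(q, syms) \<in> S" if "j \<in> J" for j using J[OF that] l by (metis nth_mem)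
      then show ?thesis using None by (auto simp: S_def)
    next
      case (Some r)
      obtain q' acts where r: "r = (q', acts)" by fastforce
      have "(q, syms) \<in> S" using 2 Some by (auto simp: S_def)
      then obtain j where j: "j < length l" "l ! j = (q, syms)" using l by (metis in_set_conv_nth)
      have "j \<in> J" using E[OF j(1)] j ent[OF j(1)] by (auto simp: J_def e'[unfolded One_nat_def])
      moreover have "dec (table_entry e j) 2 = q' \<and>
            (\<forall>i<tapes M. dec (dec (table_entry e j) 3) i = fst (acts ! i) \<and>
               int (dec (dec (table_entry e j) 4) i) = snd (acts ! i) + 1)" if "j \<in> J" for j
        using J[OF that] E[of j] ent[of j] Some r by auto
      ultimately show ?thesis using Some r by auto
    qed
    then show ?case unfolding J_def .
  qed
  then show ?thesis by blast
qed

section \<open>Coded histories and actual runs\<close>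

definition config_ok :: "tm \<Rightarrow> config \<Rightarrow> bool" where
  "config_ok M c \<longleftrightarrow> cstate c < states M \<and> (\<forall>i<tapes M. \<forall>z. content c i z < symbols M)"

lemma config_ok_step:
  assumes "tm_wf M" "config_ok M c" "tm_step M c = Some c'"
  shows "config_ok M c'" and "\<And>i. i < tapes M \<Longrightarrow> \<bar>head c' i\<bar> \<le> \<bar>head c i\<bar> + 1"
proof -
  obtain q acts where d: "delta M (cstate c) (scanned M c) = Some (q, acts)"
    and c': "c' = \<lparr>cstate = q,
      content = (\<lambda>i. if i < tapes M then (content c i)(head c i := fst (acts ! i)) else content c i),
      head = (\<lambda>i. if i < tapes M then head c i + snd (acts ! i) else head c i)\<rparr>"
    using assms(3) by (auto simp: tm_step_def)
  have "length (scanned M c) = tapes M" "set (scanned M c) \<subseteq> {..<symbols M}"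
    using assms(2) by (auto simp: scanned_def config_ok_def)
  with assms(1,2) d have q: "q < states M" "length acts = tapes M"
      "set acts \<subseteq> {..<symbols M} \<times> {-1, 0, 1}"
    unfolding tm_wf_def config_ok_def by blast+
  have a: "acts ! i \<in> {..<symbols M} \<times> {-1, 0, 1}" if "i < tapes M" for i
    using q that by (metis nth_mem subsetD)
  show "config_ok M c'" using q(1) a assms(2) by (fastforce simp: config_ok_def c')
  show "\<bar>head c' i\<bar> \<le> \<bar>head c i\<bar> + 1" if "i < tapes M" for i
    using a[OF that] that by (auto simp: c')
qed

definition config_code :: "tm \<Rightarrow> nat \<Rightarrow> nat \<Rightarrow> nat \<Rightarrow> config \<Rightarrow> bool" where
  "config_code M L W C c \<longleftrightarrow> dec C 0 = cstate c \<and>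
     (\<forall>i<tapes M. int (head_code C i) = head c i + int L \<and>
        (\<forall>z<W. cell_code C i z = content c i (int z - int L)))"

lemma ex_config_code:
  assumes "\<And>i. i < tapes M \<Longrightarrow> \<bar>head c i\<bar> \<le> int L"
  shows "\<exists>C. config_code M L W C c"
proof -
  obtain h where h: "\<forall>i<tapes M. dec h i = nat (head c i + int L)"
    using ex_dec[of _ "\<lambda>i. nat (head c i + int L)"] by blast
  have "\<exists>w. \<forall>z<W. dec w z = content c i (int z - int L)" for i
    using ex_dec[of W "\<lambda>z. content c i (int z - int L)"] .
  then obtain w where w: "\<And>i. \<forall>z<W. dec (w i) z = content c i (int z - int L)" by metis
  obtain T where T: "\<forall>i<tapes M. dec T i = w i" using ex_dec[of _ w] by blast
  obtain C where C: "\<forall>i<3. dec C i = [cstate c, h, T] ! i"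
    using ex_dec[of 3 "\<lambda>i. [cstate c, h, T] ! i"] by blast
  have "dec C 0 = cstate c" "dec C 1 = h" "dec C 2 = T"
    using C[rule_format, of 0] C[rule_format, of 1] C[rule_format, of 2] by (simp_all add: eval_nat_numeral)
  moreover have "head c i + int L \<ge> 0" if "i < tapes M" for i using assms[OF that] by linarith
  ultimately have "config_code M L W C c"
    using h T w by (simp add: config_code_def head_code_def cell_code_def)
  then show ?thesis by blast
qed

text \<open>As long as the heads are inside the window, the coded scanned symbols are the actual
  ones, so both claims reduce to the set \<open>J\<close> of matching table entries.\<close>

lemma step_code_iff:
  assumes code: "tm_code e M" and wf: "tm_wf M" and ok: "config_ok M c" and C: "config_code M L W C c"
    and hd: "\<And>i. i < tapes M \<Longrightarrow> head c i + int L < int W"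
  shows "halt_code e C \<longleftrightarrow> tm_step M c = None"
    and "step_code e W C C' \<longleftrightarrow> (\<exists>c'. tm_step M c = Some c' \<and> config_code M L W C' c')"
proof -
  have K: "dec e 0 = tapes M" using code by (simp add: tm_code_def)
  have "cell_code C i (head_code C i) = scanned M c ! i" if "i < tapes M" for i
  proof -
    have "head_code C i < W" "int (head_code C i) - int L = head c i"
      using C hd[OF that] that by (auto simp: config_code_def)
    then show ?thesis using C that by (auto simp: config_code_def scanned_def)
  qed
  then have m: "entry_matches (dec e 0) (table_entry e j) C \<longleftrightarrow> dec (table_entry e j) 0 = cstate c \<and>
      (\<forall>i<tapes M. dec (dec (table_entry e j) 1) i = scanned M c ! i)" for j
    using C by (auto simp: entry_matches_def K config_code_def)
  define J where "J = {j. j < dec e 1 \<and> entry_matches (dec e 0) (table_entry e j) C}"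
  have "length (scanned M c) = tapes M" "set (scanned M c) \<subseteq> {..<symbols M}" "cstate c < states M"
    using ok by (auto simp: scanned_def config_ok_def)
  with code have d: "case delta M (cstate c) (scanned M c) of None \<Rightarrow> J = {}
        | Some (q', acts) \<Rightarrow> J \<noteq> {} \<and> (\<forall>j\<in>J. dec (table_entry e j) 2 = q' \<and>
            (\<forall>i<tapes M. dec (dec (table_entry e j) 3) i = fst (acts ! i) \<and>
               int (dec (dec (table_entry e j) 4) i) = snd (acts ! i) + 1))"
    unfolding tm_code_def Let_def J_def m by blast
  have h: "halt_code e C \<longleftrightarrow> J = {}" by (auto simp: halt_code_def J_def)
  show "halt_code e C \<longleftrightarrow> tm_step M c = None"
    unfolding h using d by (auto simp: tm_step_def split: option.splits)
  show "step_code e W C C' \<longleftrightarrow> (\<exists>c'. tm_step M c = Some c' \<and> config_code M L W C' c')"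
  proof (cases "delta M (cstate c) (scanned M c)")
    case None
    then show ?thesis using d by (auto simp: tm_step_def step_code_def J_def)
  next
    case (Some r)
    obtain q acts where r: "r = (q, acts)" by fastforce
    define c' where "c' = \<lparr>cstate = q,
      content = (\<lambda>i. if i < tapes M then (content c i)(head c i := fst (acts ! i)) else content c i),
      head = (\<lambda>i. if i < tapes M then head c i + snd (acts ! i) else head c i)\<rparr>"
    have st: "tm_step M c = Some c'" using Some r by (simp add: tm_step_def c'_def)
    have J: "J \<noteq> {}" "\<And>j. j \<in> J \<Longrightarrow> dec (table_entry e j) 2 = q"
        "\<And>j i. j \<in> J \<Longrightarrow> i < tapes M \<Longrightarrow> dec (dec (table_entry e j) 3) i = fst (acts ! i)"
        "\<And>j i. j \<in> J \<Longrightarrow> i < tapes M \<Longrightarrow> int (dec (dec (table_entry e j) 4) i) = snd (acts ! i) + 1"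
      using d Some r by auto
    have "dec C' 0 = dec (table_entry e j) 2 \<and>
     (\<forall>i<dec e 0. Suc (head_code C' i) = head_code C i + dec (dec (table_entry e j) 4) i \<and>
        (\<forall>z<W. cell_code C' i z =
           (if z = head_code C i then dec (dec (table_entry e j) 3) i else cell_code C i z)))
      \<longleftrightarrow> config_code M L W C' c'" if j: "j \<in> J" for j
    proof -
      have "Suc (head_code C' i) = head_code C i + dec (dec (table_entry e j) 4) i \<longleftrightarrow>
          int (head_code C' i) = head c' i + int L" if "i < tapes M" for i
      proof -
        have "int (head_code C i) = head c i + int L" using C that by (simp add: config_code_def)
        with J(4)[OF j that] show ?thesis using that by (simp add: c'_def) linarith
      qed
      moreover have "(if z = head_code C i then dec (dec (table_entry e j) 3) i else cell_code C i z) =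
          content c' i (int z - int L)" if "i < tapes M" "z < W" for i z
      proof -
        have "int (head_code C i) = head c i + int L" using C that by (simp add: config_code_def)
        then have "z = head_code C i \<longleftrightarrow> int z - int L = head c i" by linarith
        with J(3)[OF j that(1)] show ?thesis using C that by (simp add: c'_def config_code_def)
      qed
      ultimately show ?thesis using J(2)[OF j] by (auto simp: config_code_def K c'_def[THEN arg_cong[of _ _ cstate]])
    qed
    then have "step_code e W C C' \<longleftrightarrow> (\<exists>j\<in>J. config_code M L W C' c')"
      unfolding step_code_def J_def by blast
    then show ?thesis using J(1) st by auto
  qed
qed

lemma tm_steps_halt_unique:
  assumes "tm_steps M c0 c" "tm_step M c = None" "tm_steps M c0 c'" "tm_step M c' = None"
  shows "c = c'"
  using assms
proof (induction rule: converse_rtranclp_induct)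
  case base
  then show ?case by (auto elim: converse_rtranclpE)
next
  case (step a b)
  from step.prems(2) show ?case
  proof (cases rule: converse_rtranclpE)
    case base
    then show ?thesis using step by simp
  next
    case (step b')
    then show ?thesis using \<open>tm_step M a = Some b\<close> step.IH step.prems by auto
  qed
qed

text \<open>In \<open>L\<close> steps no head gets farther than \<open>L\<close> from the origin.
  These cells have positions \<open>0\<close> to \<open>2 * L\<close>, all below \<open>W\<close>,
  so a history follows the actual run, and determinism identifies its last configuration.
  Conversely, the halting run is coded step by step.\<close>

lemma history_iff:
  assumes code: "tm_code e M" and wf: "tm_wf M" and comp: "computes M m f"
    and xs: "length xs = m" and X: "\<And>i. dec X i = regs xs i"
  shows "(\<exists>t. history e X m y t) \<longleftrightarrow> y = f xs"
proof -
  have K: "dec e 0 = tapes M" using code by (simp add: tm_code_def)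
  have mK: "m < tapes M" using comp by (simp add: computes_def)
  obtain c where c: "tm_steps M (initial xs) c" "tm_step M c = None" "content c m = unary (f xs)"
    using comp xs unfolding computes_def by blast
  have ok0: "config_ok M (initial xs)"
    using wf by (auto simp: config_ok_def initial_def tm_wf_def unary_def)
  have init: "init_code e X L W C \<longleftrightarrow> config_code M L W C (initial xs)" for L W C
  proof -
    have "(if L \<le> z \<and> z < L + regs xs i then 1 else 0) = content (initial xs) i (int z - int L)" for i z
      by (auto simp: initial_def regs_def unary_def)
    then show ?thesis by (auto simp: init_code_def config_code_def K X initial_def)
  qed
  have out: "content c m (int z - int L) = (if L \<le> z \<and> z < L + f xs then 1 else 0)" for z L
    by (auto simp: c(3) unary_def)
  show ?thesis
  proof
    assume "\<exists>t. history e X m y t"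
    then obtain t where t: "history e X m y t" by blast
    define L W where "L = dec t 0" and "W = dec t 1"
    define H where "H j = dec (dec t 2) j" for j
    have h: "2 * L < W" "L + y < W" "init_code e X L W (H 0)"
      "\<And>j. j < L \<Longrightarrow> step_code e W (H j) (H (Suc j))" "halt_code e (H L)"
      "\<And>z. z < W \<Longrightarrow> cell_code (H L) m z = (if L \<le> z \<and> z < L + y then 1 else 0)"
      using t by (auto simp: history_def L_def W_def H_def)
    have "\<exists>c'. tm_steps M (initial xs) c' \<and> config_ok M c' \<and> config_code M L W (H j) c' \<and>
       (\<forall>i<tapes M. \<bar>head c' i\<bar> \<le> int j)" if "j \<le> L" for j
      using that
    proof (induction j)
      case 0
      then show ?case using ok0 h(3) init by (intro exI[of _ "initial xs"]) (auto simp: initial_def)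
    next
      case (Suc j)
      then obtain c' where c': "tm_steps M (initial xs) c'" "config_ok M c'" "config_code M L W (H j) c'"
          "\<forall>i<tapes M. \<bar>head c' i\<bar> \<le> int j" by auto
      have "head c' i + int L < int W" if "i < tapes M" for i
        using c'(4) that h(1) Suc.prems by fastforce
      from step_code_iff(2)[OF code wf c'(2,3) this] h(4)[of j] Suc.prems
      obtain c'' where c'': "tm_step M c' = Some c''" "config_code M L W (H (Suc j)) c''" by auto
      have "\<bar>head c'' i\<bar> \<le> int (Suc j)" if "i < tapes M" for i
        using config_ok_step(2)[OF wf c'(2) c''(1) that] c'(4) that by fastforce
      then show ?case using c'(1) c'' config_ok_step(1)[OF wf c'(2) c''(1)]
        by (meson rtranclp.rtrancl_into_rtrancl)
    qed
    from this[of L] obtain c' where c': "tm_steps M (initial xs) c'" "config_ok M c'"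
        "config_code M L W (H L) c'" "\<forall>i<tapes M. \<bar>head c' i\<bar> \<le> int L" by auto
    have "head c' i + int L < int W" if "i < tapes M" for i
      using c'(4) that h(1) by fastforce
    from step_code_iff(1)[OF code wf c'(2,3) this] h(5) have "tm_step M c' = None" by blast
    then have "c' = c" using tm_steps_halt_unique c c' by blast
    then have "(if L \<le> z \<and> z < L + y then 1 else 0) = (if L \<le> z \<and> z < L + f xs then 1 else (0::nat))" if "z < W" for z
      using h(6)[OF that] c'(3) mK that out[of z L] by (auto simp: config_code_def)
    \<comment> \<open>The blank behind the shorter of the two results distinguishes them; it is
      visible because \<open>L + y < W\<close> is strict.\<close>
    from this[of "L + y"] this[of "L + f xs"] h(2) show "y = f xs"
      by (auto split: if_splits)
  next
    assume y: "y = f xs"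
    obtain L where "((\<lambda>c c'. tm_step M c = Some c') ^^ L) (initial xs) c"
      using c(1) by (auto simp: rtranclp_power)
    then obtain g where g: "g 0 = initial xs" "g L = c" "\<And>j. j < L \<Longrightarrow> tm_step M (g j) = Some (g (Suc j))"
      by (auto simp: relpowp_fun_conv)
    have ok: "config_ok M (g j) \<and> (\<forall>i<tapes M. \<bar>head (g j) i\<bar> \<le> int j)" if "j \<le> L" for j
      using that
    proof (induction j)
      case 0
      then show ?case using ok0 g(1) by (simp add: initial_def)
    next
      case (Suc j)
      then have j: "config_ok M (g j)" "\<forall>i<tapes M. \<bar>head (g j) i\<bar> \<le> int j"
        "tm_step M (g j) = Some (g (Suc j))" using g(3) by auto
      have "\<bar>head (g (Suc j)) i\<bar> \<le> int (Suc j)" if "i < tapes M" for i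
        using config_ok_step(2)[OF wf j(1,3) that] j(2) that by fastforce
      then show ?case using config_ok_step(1)[OF wf j(1,3)] by blast
    qed
    \<comment> \<open>The least width that exceeds both \<open>2 * L + y\<close> and hence every
      position needed for the heads and for the output.\<close>
    define W where "W = Suc (2 * L + y)"
    have "\<exists>C. config_code M L W C (g j)" if "j \<le> L" for j
      using ok[OF that] that by (intro ex_config_code) fastforce
    then obtain H where H: "\<And>j. j \<le> L \<Longrightarrow> config_code M L W (H j) (g j)" by metis
    obtain D where D: "\<forall>j<Suc L. dec D j = H j" using ex_dec[of _ H] by blast
    obtain t where t: "\<forall>i<3. dec t i = [L, W, D] ! i" using ex_dec[of 3 "\<lambda>i. [L, W, D] ! i"] by blast
    have t': "dec t 0 = L" "dec t 1 = W" "dec t 2 = D"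
      using t[rule_format, of 0] t[rule_format, of 1] t[rule_format, of 2] by (simp_all add: eval_nat_numeral)
    have hd: "head (g j) i + int L < int W" if "j \<le> L" "i < tapes M" for i j
      using ok[OF that(1)] that by (fastforce simp: W_def)
    have "step_code e W (H j) (H (Suc j))" if "j < L" for j
    proof -
      have j: "j \<le> L" "Suc j \<le> L" using that by auto
      have okj: "config_ok M (g j)" using ok[OF j(1)] by blast
      show ?thesis
        using step_code_iff(2)[OF code wf okj H[OF j(1)] hd[OF j(1)], of "H (Suc j)"]
          H[OF j(2)] g(3)[OF that] by blast
    qed
    moreover have okL: "config_ok M (g L)" using ok[of L] by simp
    have "halt_code e (H L)"
      using step_code_iff(1)[OF code wf okL H[OF le_refl] hd[OF le_refl]] c(2) g(2) by simp
    moreover have "cell_code (H L) m z = (if L \<le> z \<and> z < L + y then 1 else 0)" if "z < W" for z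
      using H[of L] that mK out[of z L] y g(2) by (simp add: config_code_def)
    moreover have "init_code e X L W (H 0)" using H[of 0] g(1) init by simp
    ultimately have "history e X m y t" using D by (simp add: history_def t'[unfolded One_nat_def] W_def)
    then show "\<exists>t. history e X m y t" by blast
  qed
qed

lemma computes_history:
  assumes "tm_wf M" "computes M m f"
  obtains e where "\<And>xs X y. length xs = m \<Longrightarrow> (\<And>i. dec X i = regs xs i) \<Longrightarrow>
      (\<exists>t. history e X m y t) \<longleftrightarrow> y = f xs"
  using ex_tm_code[OF assms(1)] history_iff[OF _ assms] that by metis

text \<open>This is Kleene's normal form: one search runs over pairs of an output and a history, and
  the output is read off the pair that is found.\<close>

lemma cf_of_computes:
  assumes e: "\<And>env y. (\<exists>t. history e (x env) m y t) \<longleftrightarrow> y = F env" and x: "cf x"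
  shows "cf F"
proof -
  have "hdn (LEAST w. history e (x env) m (hdn w) (tln w)) = F env" for env
  proof -
    obtain t where "history e (x env) m (F env) t" using e by blast
    then have "\<exists>w. history e (x env) m (hdn w) (tln w)"
      by (intro exI[of _ "prod_encode (F env, t)"]) simp
    then have "history e (x env) m (hdn (LEAST w. history e (x env) m (hdn w) (tln w)))
        (tln (LEAST w. history e (x env) m (hdn w) (tln w)))"
      by (rule LeastI_ex)
    then show ?thesis using e by blast
  qed
  moreover have "cf (\<lambda>env. hdn (LEAST w. history e (x env) m (hdn w) (tln w)))"
  proof (intro cf_hdn cf_LEAST)
    show "cfp (\<lambda>env. history e (x (\<lambda>i. env (Suc i))) m (hdn (env 0)) (tln (env 0)))"
      by (intro cfp_history cf_const cf_shift x cf_hdn cf_tln cf_var)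
    fix env
    obtain t where "history e (x env) m (F env) t" using e by blast
    then show "\<exists>w. history e (x env) m (hdn w) (tln w)"
      by (intro exI[of _ "prod_encode (F env, t)"]) simp
  qed
  ultimately show ?thesis by simp
qed

text \<open>The converse of \<open>cf_recursive1\<close>. It is what makes the machines provided by
  a computability assumption usable as subroutines.\<close>

lemma recursive1_cf: "recursive1 f \<Longrightarrow> cf (\<lambda>e. f (e 0))"
  unfolding recursive1_def
proof (elim exE conjE)
  fix M assume "tm_wf M" "computes M 1 (\<lambda>xs. f (xs ! 0))"
  then obtain e where e: "\<And>xs X y. length xs = 1 \<Longrightarrow> (\<And>i. dec X i = regs xs i) \<Longrightarrow>
      (\<exists>t. history e X 1 y t) \<longleftrightarrow> y = f (xs ! 0)" using computes_history by blast
  have X: "dec (prod_encode (a, 0)) i = regs [a] i" for a i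
    by (cases i) (auto simp: regs_def dec_0 dec_Suc)
  have h: "(\<exists>t. history e (prod_encode (a, 0)) 1 y t) \<longleftrightarrow> y = f a" for a y
    using e[of "[a]", OF _ X] by simp
  show ?thesis
    by (rule cf_of_computes[OF h]) (intro cf_prod_encode cf_var cf_const)
qed

lemma recursive2_cf: "recursive2 f \<Longrightarrow> cf (\<lambda>e. f (e 0) (e 1))"
  unfolding recursive2_def
proof (elim exE conjE)
  fix M assume "tm_wf M" "computes M 2 (\<lambda>xs. f (xs ! 0) (xs ! 1))"
  then obtain e where e: "\<And>xs X y. length xs = 2 \<Longrightarrow> (\<And>i. dec X i = regs xs i) \<Longrightarrow>
      (\<exists>t. history e X 2 y t) \<longleftrightarrow> y = f (xs ! 0) (xs ! 1)" using computes_history by blast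
  have X: "dec (prod_encode (a, prod_encode (b, 0))) i = regs [a, b] i" for a b i
    by (cases i; cases "i - 1") (auto simp: regs_def dec_0 dec_Suc)
  have h: "(\<exists>t. history e (prod_encode (a, prod_encode (b, 0))) 2 y t) \<longleftrightarrow> y = f a b" for a b y
    using e[of "[a, b]", OF _ X] by simp
  show ?thesis
    by (rule cf_of_computes[OF h]) (intro cf_prod_encode cf_var cf_const)
qed

section \<open>The diagonal argument\<close>

definition self_halts_at :: "nat \<Rightarrow> nat \<Rightarrow> bool" where
  "self_halts_at l t \<longleftrightarrow> history l (prod_encode (l, 0)) 1 0 t"

lemma cfp_self_halts_at: "cf a \<Longrightarrow> cf b \<Longrightarrow> cfp (\<lambda>e. self_halts_at (a e) (b e))"
  unfolding self_halts_at_def by (intro cfp_history cf_prod_encode cf_const)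

text \<open>Since \<open>self_halts_at\<close> also requires the output \<open>0\<close>, the
  diagonal argument stays within total functions: a machine \<open>e\<close> for the decision
  function \<open>D\<close> outputs \<open>0\<close> on \<open>e\<close> exactly if
  \<open>D e = 0\<close>, whereas \<open>D\<close> then has to answer \<open>1\<close>.\<close>

theorem halting_undecidable: "\<not> cfp (\<lambda>e. \<exists>t. self_halts_at (e 0) t)"
proof
  define D where "D l = (if \<exists>t. self_halts_at l t then 1 else (0::nat))" for l
  assume "cfp (\<lambda>e. \<exists>t. self_halts_at (e 0) t)"
  then have "recursive1 D"
    unfolding cfp_def by (intro cf_recursive1) (simp add: D_def)
  then obtain M where "tm_wf M" "computes M 1 (\<lambda>xs. D (xs ! 0))"
    unfolding recursive1_def by blast
  then obtain e where e: "\<And>xs X y. length xs = 1 \<Longrightarrow> (\<And>i. dec X i = regs xs i) \<Longrightarrow>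
      (\<exists>t. history e X 1 y t) \<longleftrightarrow> y = D (xs ! 0)" using computes_history by blast
  have X: "dec (prod_encode (a, 0)) i = regs [a] i" for a i
    by (cases i) (auto simp: regs_def dec_0 dec_Suc)
  have "(\<exists>t. self_halts_at e t) \<longleftrightarrow> D e = 0"
    using e[of "[e]", OF _ X, of 0] unfolding self_halts_at_def by auto
  then show False by (simp add: D_def split: if_splits)
qed

section \<open>Computable rational-valued functions and computable reals\<close>

text \<open>Numerators are differences of naturals instead of a sign and a modulus, so sums and
  products of rationals become polynomial expressions in naturals.\<close>

definition crat :: "((nat \<Rightarrow> nat) \<Rightarrow> real) \<Rightarrow> bool" where
  "crat f \<longleftrightarrow> (\<exists>a b q. cf a \<and> cf b \<and> cf q \<and>
     (\<forall>e. q e \<noteq> 0 \<and> f e = (real (a e) - real (b e)) / real (q e)))"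

lemma cratI:
  "cf a \<Longrightarrow> cf b \<Longrightarrow> cf q \<Longrightarrow> (\<And>e. q e \<noteq> 0) \<Longrightarrow>
    (\<And>e. f e = (real (a e) - real (b e)) / real (q e)) \<Longrightarrow> crat f"
  unfolding crat_def by blast

lemma crat_const:
  assumes "c \<in> \<rat>"
  shows "crat (\<lambda>e. c)"
proof -
  obtain m n where mn: "n > 0" "c = of_int m / of_int n"
    using assms by (cases rule: Rats_cases') auto
  have "real (nat m) - real (nat (- m)) = of_int m" "real (nat n) = of_int n" "nat n \<noteq> 0"
    using mn(1) by auto
  with mn(2) show ?thesis
    by (intro cratI[of "\<lambda>e. nat m" "\<lambda>e. nat (- m)" "\<lambda>e. nat n"] cf_const) auto
qed

lemma crat_app:
  assumes "crat (\<lambda>e. r (e 0))" "cf a"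
  shows "crat (\<lambda>e. r (a e))"
proof -
  obtain p n q where *: "cf p" "cf n" "cf q" "\<And>e. q e \<noteq> 0"
      "\<And>e. r (e 0) = (real (p e) - real (n e)) / real (q e)"
    using assms(1) unfolding crat_def by blast
  \<comment> \<open>The representing functions may read any variable although the quotient depends
    on variable \<open>0\<close> only; all variables are therefore set to
    \<open>a e\<close>.\<close>
  have "cf (\<lambda>e. g (\<lambda>_. a e))" if "cf g" for g
    using cf_app1[OF cf_rename[OF that, of "\<lambda>_. 0"] assms(2)] .
  with * show ?thesis
    by (intro cratI[of "\<lambda>e. p (\<lambda>_. a e)" "\<lambda>e. n (\<lambda>_. a e)" "\<lambda>e. q (\<lambda>_. a e)"])
      (auto simp flip: *(5))
qed

lemma crat_add:
  assumes "crat f" "crat g"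
  shows "crat (\<lambda>e. f e + g e)"
proof -
  obtain a b q where 1: "cf a" "cf b" "cf q" "\<And>e. q e \<noteq> 0"
      "\<And>e. f e = (real (a e) - real (b e)) / real (q e)" using assms(1) unfolding crat_def by blast
  obtain a' b' q' where 2: "cf a'" "cf b'" "cf q'" "\<And>e. q' e \<noteq> 0"
      "\<And>e. g e = (real (a' e) - real (b' e)) / real (q' e)" using assms(2) unfolding crat_def by blast
  have "f e + g e = (real (a e * q' e + a' e * q e) - real (b e * q' e + b' e * q e)) / real (q e * q' e)" for e
    using 1(4)[of e] 2(4)[of e] by (simp add: 1(5) 2(5) field_simps)
  moreover have "q e * q' e \<noteq> 0" for e using 1(4) 2(4) by simp
  ultimately show ?thesis
    using 1(1-3) 2(1-3) by (intro cratI[of "\<lambda>e. a e * q' e + a' e * q e"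
          "\<lambda>e. b e * q' e + b' e * q e" "\<lambda>e. q e * q' e"] cf_plus cf_mult)
qed

lemma crat_mult:
  assumes "crat f" "crat g"
  shows "crat (\<lambda>e. f e * g e)"
proof -
  obtain a b q where 1: "cf a" "cf b" "cf q" "\<And>e. q e \<noteq> 0"
      "\<And>e. f e = (real (a e) - real (b e)) / real (q e)" using assms(1) unfolding crat_def by blast
  obtain a' b' q' where 2: "cf a'" "cf b'" "cf q'" "\<And>e. q' e \<noteq> 0"
      "\<And>e. g e = (real (a' e) - real (b' e)) / real (q' e)" using assms(2) unfolding crat_def by blast
  have "f e * g e = (real (a e * a' e + b e * b' e) - real (a e * b' e + b e * a' e)) / real (q e * q' e)" for e
    using 1(4)[of e] 2(4)[of e] by (simp add: 1(5) 2(5) field_simps)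
  moreover have "q e * q' e \<noteq> 0" for e using 1(4) 2(4) by simp
  ultimately show ?thesis
    using 1(1-3) 2(1-3) by (intro cratI[of "\<lambda>e. a e * a' e + b e * b' e"
          "\<lambda>e. a e * b' e + b e * a' e" "\<lambda>e. q e * q' e"] cf_plus cf_mult)
qed

lemma crat_if:
  assumes "cfp P" "crat f" "crat g"
  shows "crat (\<lambda>e. if P e then f e else g e)"
proof -
  obtain a b q where 1: "cf a" "cf b" "cf q" "\<And>e. q e \<noteq> 0"
      "\<And>e. f e = (real (a e) - real (b e)) / real (q e)" using assms(2) unfolding crat_def by blast
  obtain a' b' q' where 2: "cf a'" "cf b'" "cf q'" "\<And>e. q' e \<noteq> 0"
      "\<And>e. g e = (real (a' e) - real (b' e)) / real (q' e)" using assms(3) unfolding crat_def by blast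
  show ?thesis
    by (rule cratI[of "\<lambda>e. if P e then a e else a' e" "\<lambda>e. if P e then b e else b' e"
          "\<lambda>e. if P e then q e else q' e"])
      (use 1 2 in \<open>auto intro!: cf_if assms(1)\<close>)
qed

lemma cfp_crat_less:
  assumes "crat f" "crat g"
  shows "cfp (\<lambda>e. f e < g e)"
proof -
  obtain a b q where 1: "cf a" "cf b" "cf q" "\<And>e. q e \<noteq> 0"
      "\<And>e. f e = (real (a e) - real (b e)) / real (q e)" using assms(1) unfolding crat_def by blast
  obtain a' b' q' where 2: "cf a'" "cf b'" "cf q'" "\<And>e. q' e \<noteq> 0"
      "\<And>e. g e = (real (a' e) - real (b' e)) / real (q' e)" using assms(2) unfolding crat_def by blast
  have "f e < g e \<longleftrightarrow> a e * q' e + b' e * q e < a' e * q e + b e * q' e" for e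
  proof -
    have "f e < g e \<longleftrightarrow> real (a e * q' e + b' e * q e) < real (a' e * q e + b e * q' e)"
      using 1(4)[of e] 2(4)[of e] unfolding 1(5) 2(5)
      by (simp add: divide_simps) (simp add: algebra_simps)
    then show ?thesis by (simp only: of_nat_less_iff)
  qed
  then show ?thesis using 1 2 by (simp only:) (intro cfp_less cf_plus cf_mult)
qed

text \<open>One of the two truncated differences is \<open>0\<close>, so their sum is the absolute
  value of the numerator.\<close>

lemma sign_form:
  "(real a - real b) / real q = (-1) ^ (if a < b then 1 else 0) * (real ((a - b) + (b - a)) / real q)"
  by (auto simp: of_nat_diff minus_divide_left)

lemma crat_sign_form:
  assumes "cf s" "cf p" "cf q" "\<And>e. q e \<noteq> 0" "\<And>e. f e = (-1) ^ s e * (real (p e) / real (q e))"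
  shows "crat f"
proof -
  have "even n \<longleftrightarrow> (\<exists>j<Suc n. n = 2 * j)" for n :: nat
    by (auto elim!: evenE)
  then have "cfp (\<lambda>e. even (s e))"
    by (simp only:) (intro cf_intros assms(1) cf_shift)
  then show ?thesis
    using assms
    by (intro cratI[of "\<lambda>e. if even (s e) then p e else 0" "\<lambda>e. if even (s e) then 0 else p e" q])
      (auto intro!: cf_if cf_const)
qed

lemma computable_rat_seq_iff: "computable_rat_seq r \<longleftrightarrow> crat (\<lambda>e. r (e 0))"
proof
  assume "computable_rat_seq r"
  then obtain s p q where "recursive1 s" "recursive1 p" "recursive1 q"
      "\<And>k. q k \<noteq> 0 \<and> r k = (-1) ^ s k * (real (p k) / real (q k))"
    unfolding computable_rat_seq_def by blast
  then show "crat (\<lambda>e. r (e 0))"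
    by (intro crat_sign_form[of "\<lambda>e. s (e 0)" "\<lambda>e. p (e 0)" "\<lambda>e. q (e 0)"]) (auto dest: recursive1_cf)
next
  assume "crat (\<lambda>e. r (e 0))"
  then obtain a b q where *: "cf a" "cf b" "cf q" "\<And>e. q e \<noteq> 0"
      "\<And>e. r (e 0) = (real (a e) - real (b e)) / real (q e)" unfolding crat_def by blast
  have c: "cf (\<lambda>e. g (\<lambda>_. e 0))" if "cf g" for g using cf_rename[OF that] .
  let ?a = "\<lambda>k. a (\<lambda>_. k)" and ?b = "\<lambda>k. b (\<lambda>_. k)" and ?q = "\<lambda>k. q (\<lambda>_. k)"
  have "recursive1 (\<lambda>k. if ?a k < ?b k then 1 else 0)" "recursive1 (\<lambda>k. (?a k - ?b k) + (?b k - ?a k))"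
      "recursive1 ?q"
    by (intro cf_recursive1 cf_intros *(1-3)[THEN c])+
  moreover have "r k = (-1) ^ (if ?a k < ?b k then 1 else 0) * (real ((?a k - ?b k) + (?b k - ?a k)) / real (?q k))" for k
    using *(5)[of "\<lambda>_. k"] by (simp only: sign_form)
  ultimately show "computable_rat_seq r"
    unfolding computable_rat_seq_def using *(4) by blast
qed

lemma computable_rat_seq2_iff: "computable_rat_seq2 r \<longleftrightarrow> crat (\<lambda>e. r (e 0) (e 1))"
proof
  assume "computable_rat_seq2 r"
  then obtain s p q where "recursive2 s" "recursive2 p" "recursive2 q"
      "\<And>l k. q l k \<noteq> 0 \<and> r l k = (-1) ^ s l k * (real (p l k) / real (q l k))"
    unfolding computable_rat_seq2_def by blast
  then show "crat (\<lambda>e. r (e 0) (e 1))"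
    by (intro crat_sign_form[of "\<lambda>e. s (e 0) (e 1)" "\<lambda>e. p (e 0) (e 1)" "\<lambda>e. q (e 0) (e 1)"])
      (auto dest: recursive2_cf)
next
  assume "crat (\<lambda>e. r (e 0) (e 1))"
  then obtain a b q where *: "cf a" "cf b" "cf q" "\<And>e. q e \<noteq> 0"
      "\<And>e. r (e 0) (e 1) = (real (a e) - real (b e)) / real (q e)" unfolding crat_def by blast
  let ?E = "\<lambda>l k i :: nat. if i = 0 then l else (k :: nat)"
  have c: "cf (\<lambda>e. g (?E (e 0) (e 1)))" if "cf g" for g
    using cf_rename[OF that, of "\<lambda>i. if i = 0 then 0 else 1"] by (simp add: if_distrib)
  let ?a = "\<lambda>l k. a (?E l k)" and ?b = "\<lambda>l k. b (?E l k)" and ?q = "\<lambda>l k. q (?E l k)"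
  have "recursive2 (\<lambda>l k. if ?a l k < ?b l k then 1 else 0)"
      "recursive2 (\<lambda>l k. (?a l k - ?b l k) + (?b l k - ?a l k))" "recursive2 ?q"
    by (intro cf_recursive2 cf_intros *(1-3)[THEN c])+
  moreover have "r l k = (-1) ^ (if ?a l k < ?b l k then 1 else 0) *
      (real ((?a l k - ?b l k) + (?b l k - ?a l k)) / real (?q l k))" for l k
  proof -
    have "r l k = (real (?a l k) - real (?b l k)) / real (?q l k)"
      using *(5)[of "?E l k"] by simp
    then show ?thesis by (simp only: sign_form)
  qed
  ultimately show "computable_rat_seq2 r"
    unfolding computable_rat_seq2_def using *(4) by blast
qed

lemma Rc_iff: "x \<in> Rc \<longleftrightarrow> (\<exists>r. crat (\<lambda>e. r (e 0)) \<and> (\<forall>k. \<bar>r k - x\<bar> \<le> 1 / 2 ^ k))"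
  by (simp add: Rc_def computable_rat_seq_iff)

lemma Rats_Rc: "c \<in> \<rat> \<Longrightarrow> c \<in> Rc"
  unfolding Rc_iff by (rule exI[of _ "\<lambda>_. c"]) (auto intro: crat_const)

lemma Rc_add:
  assumes "x \<in> Rc" "y \<in> Rc"
  shows "x + y \<in> Rc"
proof -
  obtain r where r: "crat (\<lambda>e. r (e 0))" "\<And>k. \<bar>r k - x\<bar> \<le> 1 / 2 ^ k" using assms(1) unfolding Rc_iff by blast
  obtain s where s: "crat (\<lambda>e. s (e 0))" "\<And>k. \<bar>s k - y\<bar> \<le> 1 / 2 ^ k" using assms(2) unfolding Rc_iff by blast
  have "crat (\<lambda>e. r (Suc (e 0)) + s (Suc (e 0)))"
    by (intro crat_add crat_app[OF r(1)] crat_app[OF s(1)] cf_Suc cf_var)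
  moreover have "\<bar>r (Suc k) + s (Suc k) - (x + y)\<bar> \<le> 1 / 2 ^ k" for k
  proof -
    have "1 / 2 ^ Suc k + 1 / 2 ^ Suc k = (1 / 2 ^ k :: real)" by simp
    then show ?thesis using r(2)[of "Suc k"] s(2)[of "Suc k"] by linarith
  qed
  ultimately show ?thesis unfolding Rc_iff by (intro exI[of _ "\<lambda>k. r (Suc k) + s (Suc k)"]) auto
qed

text \<open>Rational factors are what the bases below call for: their entries and those of the
  inverse matrices are rational.\<close>

lemma Rc_mult_rat:
  assumes "c \<in> \<rat>" "x \<in> Rc"
  shows "c * x \<in> Rc"
proof -
  obtain r where r: "crat (\<lambda>e. r (e 0))" "\<And>k. \<bar>r k - x\<bar> \<le> 1 / 2 ^ k" using assms(2) unfolding Rc_iff by blast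
  obtain N where N: "\<bar>c\<bar> < 2 ^ N" using real_arch_pow[of 2 "\<bar>c\<bar>"] by auto
  have "crat (\<lambda>e. c * r (e 0 + N))"
    by (intro crat_mult crat_const assms crat_app[OF r(1)] cf_plus cf_var cf_const)
  moreover have "\<bar>c * r (k + N) - c * x\<bar> \<le> 1 / 2 ^ k" for k
  proof -
    have "\<bar>c * r (k + N) - c * x\<bar> = \<bar>c\<bar> * \<bar>r (k + N) - x\<bar>"
      by (simp add: abs_mult flip: right_diff_distrib)
    also have "\<dots> \<le> 2 ^ N * (1 / 2 ^ (k + N))"
      using N r(2)[of "k + N"] by (intro mult_mono) auto
    also have "\<dots> = 1 / 2 ^ k" by (simp add: power_add)
    finally show ?thesis .
  qed
  ultimately show ?thesis unfolding Rc_iff by (intro exI[of _ "\<lambda>k. c * r (k + N)"]) auto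
qed

lemma computable_real_seq_const: "c \<in> \<rat> \<Longrightarrow> computable_real_seq (\<lambda>l. c)"
  unfolding computable_real_seq_def computable_rat_seq2_iff
  by (rule exI[of _ "\<lambda>l k. c"]) (auto intro: crat_const)

section \<open>A computable sequence whose zeros are undecidable\<close>

definition halt_real :: "nat \<Rightarrow> real" where
  "halt_real l = (if \<exists>t. self_halts_at l t then 1 / 2 ^ (LEAST t. self_halts_at l t) else 0)"

lemma halt_real_bounds: "0 \<le> halt_real l" "halt_real l \<le> 1"
  by (auto simp: halt_real_def)

text \<open>Each single value is rational, even though no algorithm tells whether it is
  \<open>0\<close>; this is enough for the matrices built from it to be bases.\<close>

lemma halt_real_Rats: "halt_real l \<in> \<rat>"
  by (auto simp: halt_real_def)

lemma halt_real_pos_iff: "halt_real l > 0 \<longleftrightarrow> (\<exists>t. self_halts_at l t)"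
  by (auto simp: halt_real_def)

text \<open>For precision \<open>k\<close> only the witnesses up to \<open>k\<close> are inspected:
  if there is one, the value is exact, and otherwise it is at most \<open>1 / 2 ^ k\<close>, so
  \<open>0\<close> is close enough. The disjunct \<open>t = k\<close> stops the search.\<close>

lemma computable_real_seq_halt_real:
  assumes "c \<in> \<rat>" "d \<in> \<rat>" "\<bar>d\<bar> \<le> 1"
  shows "computable_real_seq (\<lambda>l. c + d * halt_real l)"
proof -
  define m where "m l k = (LEAST t. self_halts_at l t \<or> t = k)" for l k
  define r where "r l k = (if self_halts_at l (m l k) then 1 / 2 ^ m l k else (0::real))" for l k
  have m: "cf (\<lambda>e. m (e 0) (e 1))"
    unfolding m_def
    by (rule cf_LEAST) (auto intro!: cfp_disj cfp_eq cfp_self_halts_at cf_var)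
  have "crat (\<lambda>e. 1 / 2 ^ m (e 0) (e 1))"
    by (rule cratI[of "\<lambda>e. 1" "\<lambda>e. 0", OF cf_const cf_const cf_power[OF cf_const[of 2] m]]) auto
  then have r: "crat (\<lambda>e. r (e 0) (e 1))"
    unfolding r_def by (intro crat_if cfp_self_halts_at cf_var m crat_const) auto
  have err: "\<bar>r l k - halt_real l\<bar> \<le> 1 / 2 ^ k" for l k
  proof -
    have P: "self_halts_at l (m l k) \<or> m l k = k"
      unfolding m_def by (rule LeastI[of _ k]) simp
    have min: "m l k \<le> t" if "self_halts_at l t" for t
      unfolding m_def by (rule Least_le) (simp add: that)
    show ?thesis
    proof (cases "self_halts_at l (m l k)")
      case True
      then have "(LEAST t. self_halts_at l t) = m l k" using min by (intro Least_equality) auto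
      then show ?thesis using True by (auto simp: r_def halt_real_def)
    next
      case False
      with P have "m l k = k" by blast
      then have "k \<le> (LEAST t. self_halts_at l t)" if "self_halts_at l t" for t
        using min LeastI[of "self_halts_at l", OF that] by metis
      then have "halt_real l \<le> 1 / 2 ^ k"
        by (auto simp: halt_real_def intro!: divide_left_mono power_increasing)
      then show ?thesis using False halt_real_bounds(1)[of l] by (simp add: r_def)
    qed
  qed
  have "crat (\<lambda>e. c + d * r (e 0) (e 1))"
    by (intro crat_add crat_mult crat_const assms r)
  moreover have "\<bar>c + d * r l k - (c + d * halt_real l)\<bar> \<le> 1 / 2 ^ k" for l k
  proof -
    have "\<bar>c + d * r l k - (c + d * halt_real l)\<bar> = \<bar>d\<bar> * \<bar>r l k - halt_real l\<bar>"
      by (simp add: abs_mult flip: right_diff_distrib)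
    also have "\<dots> \<le> 1 * (1 / 2 ^ k)" using assms(3) err by (intro mult_mono) auto
    finally show ?thesis by simp
  qed
  ultimately show ?thesis
    unfolding computable_real_seq_def computable_rat_seq2_iff
    by (intro exI[of _ "\<lambda>l k. c + d * r l k"]) auto
qed

text \<open>The approximations with error at most 1 already decide the halting problem.\<close>

lemma no_separating_family:
  assumes "finite I" and comp: "\<And>i. i \<in> I \<Longrightarrow> computable_real_seq (g i)" and c: "\<And>i. i \<in> I \<Longrightarrow> c i \<in> \<rat>"
    and zero: "\<And>l i. halt_real l = 0 \<Longrightarrow> i \<in> I \<Longrightarrow> \<bar>g i l - c i\<bar> \<le> 1"
    and pos: "\<And>l. halt_real l > 0 \<Longrightarrow> \<exists>i\<in>I. \<bar>g i l - c i\<bar> > 3"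
  shows False
proof -
  have "\<exists>r. crat (\<lambda>e. r (e 0) (e 1)) \<and> (\<forall>l k. \<bar>r l k - g i l\<bar> \<le> 1 / 2 ^ k)" if "i \<in> I" for i
    using comp[OF that] by (simp add: computable_real_seq_def computable_rat_seq2_iff)
  then obtain r where r: "\<And>i. i \<in> I \<Longrightarrow> crat (\<lambda>e. r i (e 0) (e 1))"
      "\<And>i l k. i \<in> I \<Longrightarrow> \<bar>r i l k - g i l\<bar> \<le> 1 / 2 ^ k" by metis
  have crat: "crat (\<lambda>e. r i (e 0) 0)" if i: "i \<in> I" for i
  proof -
    obtain a b q where *: "cf a" "cf b" "cf q" "\<And>e. q e \<noteq> 0"
      "\<And>e. r i (e 0) (e 1) = (real (a e) - real (b e)) / real (q e)" using r(1)[OF i] unfolding crat_def by blast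
    let ?E = "\<lambda>l i :: nat. if i = 0 then l else (0 :: nat)"
    have sub: "cf (\<lambda>e. h (?E (e 0)))" if "cf h" for h
    proof -
      have "cf (\<lambda>e. h (\<lambda>i. if i = 0 then e (Suc 0) else e 0))"
        using cf_rename[OF that, of "\<lambda>i. if i = 0 then Suc 0 else 0"] by (simp add: if_distrib)
      then show ?thesis using cf_let[OF cf_zero, of "\<lambda>z e. h (\<lambda>i. if i = 0 then e 0 else z)"] by simp
    qed
    show ?thesis
      by (rule cratI[OF sub[OF *(1)] sub[OF *(2)] sub[OF *(3)]]) (use *(4) *(5)[of "?E _"] in auto)
  qed
  \<comment> \<open>With approximation error at most 1, the distances at most 1 become at most 2 and
    those above 3 stay above 2, so 2 is the threshold. The index set is finite, which turns the
    quantifier into a finite disjunction.\<close>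
  have dec: "cfp (\<lambda>e. \<exists>i\<in>J. \<bar>r i (e 0) 0 - c i\<bar> > 2)" if "J \<subseteq> I" for J
    using finite_subset[OF that assms(1)] that
  proof (induction J rule: finite_induct)
    case empty
    have "cfp (\<lambda>e. (0::nat) < 0)" by (intro cfp_less cf_const)
    then show ?case by simp
  next
    case (insert i J)
    have "cfp (\<lambda>e. c i + 2 < r i (e 0) 0)" "cfp (\<lambda>e. r i (e 0) 0 < c i + (- 2))"
      using insert.prems c by (intro cfp_crat_less crat crat_const crat_add; simp)+
    then have "cfp (\<lambda>e. (c i + 2 < r i (e 0) 0 \<or> r i (e 0) 0 < c i + (- 2)) \<or> (\<exists>i\<in>J. \<bar>r i (e 0) 0 - c i\<bar> > 2))"
      using insert by (intro cfp_disj) auto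
    moreover have "(c i + 2 < r i (e 0) 0 \<or> r i (e 0) 0 < c i + (- 2)) \<or> (\<exists>i\<in>J. \<bar>r i (e 0) 0 - c i\<bar> > 2) \<longleftrightarrow>
        (\<exists>i\<in>insert i J. \<bar>r i (e 0) 0 - c i\<bar> > 2)" for e :: "nat \<Rightarrow> nat"
      by (auto simp: abs_if)
    ultimately show ?case by (simp only:)
  qed
  have iff: "(\<exists>i\<in>I. \<bar>r i l 0 - c i\<bar> > 2) \<longleftrightarrow> (\<exists>t. self_halts_at l t)" for l
  proof (cases "halt_real l > 0")
    case True
    then obtain i where "i \<in> I" "\<bar>g i l - c i\<bar> > 3" using pos by blast
    moreover from this have "\<bar>r i l 0 - g i l\<bar> \<le> 1" using r(2)[of i l 0] by simp
    ultimately show ?thesis using True halt_real_pos_iff by (intro iffI bexI[of _ i]) auto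
  next
    case False
    then have z: "halt_real l = 0" using halt_real_bounds(1)[of l] by simp
    have "\<bar>r i l 0 - c i\<bar> \<le> 2" if "i \<in> I" for i
      using zero[OF z that] r(2)[OF that, of l 0] by simp
    then show ?thesis using False halt_real_pos_iff by force
  qed
  show False using dec[OF order_refl] halting_undecidable unfolding iff by blast
qed

section \<open>A family of lattices with two competing shortest bases\<close>

definition shear :: "'n \<Rightarrow> 'n \<Rightarrow> real \<Rightarrow> real ^ 'n ^ 'n" where
  "shear p q y = (\<chi> i j. if i = j then 8 else if i = q \<and> j = p then y else 0)"

lemma shear_combination:
  fixes p q :: "'n::finite"
  assumes "p \<noteq> q"
  shows "(\<Sum>i\<in>UNIV. c i *\<^sub>R (shear p q y $ i)) $ j = 8 * c j + (if j = p then y * c q else 0)"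
proof -
  have "(\<Sum>i\<in>UNIV. c i *\<^sub>R (shear p q y $ i)) $ j =
      (\<Sum>i\<in>UNIV. (if i = j then 8 * c j else 0) + (if i = q then if j = p then y * c q else 0 else 0))"
    unfolding sum_component using assms by (intro sum.cong) (auto simp: shear_def)
  then show ?thesis by (simp add: sum.distrib)
qed

lemma inj_shear: "p \<noteq> q \<Longrightarrow> inj (\<lambda>i. shear p q y $ i)"
proof (rule injI, rule ccontr)
  fix i j assume "p \<noteq> q" "shear p q y $ i = shear p q y $ j" "i \<noteq> j"
  then have "shear p q y $ i $ i = shear p q y $ j $ i" "shear p q y $ j $ j = shear p q y $ i $ j" by simp_all
  then show False using \<open>p \<noteq> q\<close> \<open>i \<noteq> j\<close> by (auto simp: shear_def split: if_splits)
qed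

lemma sum_basis_set: "inj (\<lambda>i. B $ i) \<Longrightarrow> (\<Sum>b\<in>basis_set B. f b) = (\<Sum>i\<in>UNIV. f (B $ i))"
  by (simp add: basis_set_def sum.reindex)

lemma shear_ordered_basis:
  fixes p q :: "'n::finite"
  assumes pq: "p \<noteq> q" and y: "y \<in> \<rat>"
  shows "shear p q y \<in> ordered_bases"
proof -
  let ?B = "shear p q y"
  note inj = inj_shear[OF pq, of y]
  note comb = shear_combination[OF pq]
  have "basis_set ?B \<subseteq> Rc_vectors"
    using y by (auto simp: basis_set_def Rc_vectors_def shear_def intro!: Rats_Rc)
  moreover have "Rc_independent (basis_set ?B)"
    unfolding Rc_independent_def
  proof (intro allI impI, elim conjE)
    fix c :: "real ^ 'n \<Rightarrow> real" assume "(\<Sum>b\<in>basis_set ?B. c b *\<^sub>R b) = 0"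
    then have "(\<Sum>i\<in>UNIV. c (?B $ i) *\<^sub>R (?B $ i)) $ j = 0" for j
      by (simp add: sum_basis_set[OF inj])
    then have 0: "8 * c (?B $ j) + (if j = p then y * c (?B $ q) else 0) = 0" for j
      unfolding comb .
    from 0[of q] have "c (?B $ q) = 0" using pq by simp
    then have "c (?B $ j) = 0" for j using 0[of j] by (simp split: if_splits)
    then show "\<forall>b\<in>basis_set ?B. c b = 0" by (auto simp: basis_set_def)
  qed
  moreover have "Rc_span (basis_set ?B) = Rc_vectors"
  proof
    show "Rc_span (basis_set ?B) \<subseteq> Rc_vectors"
    proof
      fix v assume "v \<in> Rc_span (basis_set ?B)"
      then obtain c where c: "v = (\<Sum>b\<in>basis_set ?B. c b *\<^sub>R b)" "\<forall>b\<in>basis_set ?B. c b \<in> Rc"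
        unfolding Rc_span_def by blast
      have cR: "c (?B $ j) \<in> Rc" for j using c(2) by (auto simp: basis_set_def)
      have "v $ j = 8 * c (?B $ j) + (if j = p then y * c (?B $ q) else 0)" for j
        unfolding c(1) sum_basis_set[OF inj] comb ..
      moreover have "8 * c (?B $ j) + (if j = p then y * c (?B $ q) else 0) \<in> Rc" for j
        using Rc_mult_rat[OF y cR] cR by (intro Rc_add Rc_mult_rat) (auto intro: Rats_Rc)
      ultimately show "v \<in> Rc_vectors" by (simp add: Rc_vectors_def)
    qed
    show "Rc_vectors \<subseteq> Rc_span (basis_set ?B)"
    proof
      fix v :: "real ^ 'n" assume "v \<in> Rc_vectors"
      then have v: "v $ j \<in> Rc" for j by (simp add: Rc_vectors_def)
      \<comment> \<open>Coefficients from the inverse matrix, with diagonal entries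
        \<open>1 / 8\<close> and the single further entry \<open>- y / 64\<close>.\<close>
      define d where "d j = (1 / 8) * v $ j + (if j = p then (- y / 64) * v $ q else 0)" for j
      have "(- y / 64) * v $ q \<in> Rc" using y v by (intro Rc_mult_rat) auto
      then have d: "d j \<in> Rc" for j
        unfolding d_def using v by (intro Rc_add Rc_mult_rat) (auto intro: Rats_Rc)
      define c where "c b = d (inv (\<lambda>i. ?B $ i) b)" for b
      have c: "c (?B $ j) = d j" for j unfolding c_def using inj by (simp add: inv_f_f)
      have "(\<Sum>b\<in>basis_set ?B. c b *\<^sub>R b) $ j = v $ j" for j
        unfolding sum_basis_set[OF inj] comb c d_def using pq by (simp add: field_simps)
      then have "v = (\<Sum>b\<in>basis_set ?B. c b *\<^sub>R b)" by (simp add: vec_eq_iff)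
      moreover have "\<forall>b\<in>basis_set ?B. c b \<in> Rc" using c d by (auto simp: basis_set_def)
      ultimately show "v \<in> Rc_span (basis_set ?B)" unfolding Rc_span_def by blast
    qed
  qed
  ultimately show ?thesis
    using inj by (simp add: ordered_bases_def Rc_basis_def) (simp add: basis_set_def)
qed

lemma shear_rows_lattice:
  fixes p q :: "'n::finite"
  assumes pq: "p \<noteq> q" and z: "z = y + 8 * of_int k"
  shows "basis_set (shear p q z) \<subseteq> lattice_of (shear p q y)"
proof -
  have "shear p q z $ i \<in> lattice_of (shear p q y)" for i
  proof -
    define l :: "'n \<Rightarrow> int" where "l j = (if j = i then 1 else if i = q \<and> j = p then k else 0)" for j
    have "shear p q z $ i = (\<Sum>j\<in>UNIV. of_int (l j) *\<^sub>R (shear p q y $ j))"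
      unfolding vec_eq_iff shear_combination[OF pq] using pq z
      by (auto simp: l_def shear_def)
    then show ?thesis unfolding lattice_of_def by blast
  qed
  then show ?thesis by (auto simp: basis_set_def)
qed

text \<open>Replacing \<open>y\<close> by \<open>z\<close> changes the basis but not the lattice.
  For \<open>z\<close> the representative of \<open>y\<close> modulo 8 with
  \<open>\<bar>z\<bar> \<le> 4\<close>, the short vectors can be read off the coordinates.\<close>

lemma shear_lattice_coords:
  fixes p q :: "'n::finite"
  assumes pq: "p \<noteq> q" and z: "z = y + 8 * of_int k" and v: "v \<in> lattice_of (shear p q y)"
  obtains l :: "'n \<Rightarrow> int" where "\<And>j. v $ j = 8 * of_int (l j) + (if j = p then z * of_int (l q) else 0)"
proof -
  obtain l :: "'n \<Rightarrow> int" where "v = (\<Sum>i\<in>UNIV. of_int (l i) *\<^sub>R (shear p q y $ i))"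
    using v unfolding lattice_of_def by blast
  then have l: "v $ j = 8 * of_int (l j) + (if j = p then y * of_int (l q) else 0)" for j
    by (simp only: shear_combination[OF pq])
  show ?thesis
    by (rule that[of "\<lambda>j. if j = p then l p - k * l q else l j"])
      (use pq in \<open>auto simp: l z algebra_simps\<close>)
qed

section \<open>Lengths of lattice vectors and the shape of optimal bases\<close>

lemma norm_ge_two_components:
  fixes v :: "real ^ 'n::finite"
  assumes "p \<noteq> q"
  shows "(v $ p)\<^sup>2 + (v $ q)\<^sup>2 \<le> (norm v)\<^sup>2"
proof -
  have "(\<Sum>i\<in>{p, q}. (v $ i)\<^sup>2) \<le> (\<Sum>i\<in>UNIV. (v $ i)\<^sup>2)" by (rule sum_mono2) auto
  then show ?thesis
    using assms by (simp add: norm_vec_def L2_set_def sum_nonneg)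
qed

text \<open>For \<open>k = 1\<close> or \<open>k = -1\<close>, no shift by a multiple of 8 makes
  \<open>z\<close> smaller in absolute value. For larger \<open>\<bar>k\<bar>\<close> the last
  summand alone is at least 256, against at most 16 + 64 on the left.\<close>

lemma shifted_multiple_ge:
  fixes m k :: int and z :: real
  assumes k: "k \<noteq> 0" and z: "\<bar>z\<bar> \<le> 4"
  shows "z\<^sup>2 + 64 \<le> (8 * of_int m + z * of_int k)\<^sup>2 + (8 * of_int k)\<^sup>2"
proof (cases "\<bar>k\<bar> = 1")
  case True
  then have k2: "k = 1 \<or> k = -1" by linarith
  have "16 * \<bar>of_int m * (z * of_int k)\<bar> \<le> 16 * (\<bar>of_int m\<bar> * 4)"
    using k2 mult_left_mono[OF z, of "\<bar>real_of_int m\<bar>"] by (auto simp: abs_mult mult.commute)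
  also have "\<dots> \<le> 64 * (of_int m)\<^sup>2"
  proof -
    have "m = 0 \<or> 1 \<le> \<bar>real_of_int m\<bar>" by linarith
    then have "\<bar>real_of_int m\<bar> \<le> (real_of_int m)\<^sup>2"
      using mult_left_mono[of 1 "\<bar>real_of_int m\<bar>" "\<bar>real_of_int m\<bar>"]
      by (auto simp: power2_eq_square)
    then show ?thesis by simp
  qed
  finally have "0 \<le> 64 * (of_int m)\<^sup>2 + 16 * (of_int m * (z * of_int k))" by linarith
  moreover have "(8 * of_int m + z * of_int k)\<^sup>2 = 64 * (of_int m)\<^sup>2 + 16 * (of_int m * (z * of_int k)) + z\<^sup>2 * (of_int k)\<^sup>2"
    by (simp add: power2_eq_square algebra_simps)
  ultimately show ?thesis using k2 by auto
next
  case False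
  then have "\<bar>k\<bar> \<ge> 2" using k by linarith
  then have "2 \<le> \<bar>real_of_int k\<bar>" by linarith
  then have "2\<^sup>2 \<le> (real_of_int k)\<^sup>2" by (metis abs_ge_zero abs_numeral abs_le_square_iff)
  moreover have "z\<^sup>2 \<le> 4\<^sup>2" using z by (metis abs_le_square_iff abs_numeral)
  moreover have "0 \<le> (8 * of_int m + z * of_int k)\<^sup>2" by simp
  moreover have "(8 * real_of_int k)\<^sup>2 = 64 * (real_of_int k)\<^sup>2" by (simp add: power_mult_distrib)
  moreover have "(2::real)\<^sup>2 = 4" "(4::real)\<^sup>2 = 16" by simp_all
  ultimately show ?thesis by linarith
qed

text \<open>Some row must have a nonzero \<open>q\<close>-entry and then has norm at least
  \<open>?C\<close>; every other row has norm at least 8. The basis \<open>shear p q z\<close>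
  attains these bounds, so an optimal basis must attain them too, and equality determines its
  \<open>q\<close>-column up to sign and order.\<close>

lemma shear_optimal_rows:
  fixes p q :: "'n::finite" and M :: "real ^ 'n ^ 'n"
  assumes pq: "p \<noteq> q" and z: "z = y + 8 * of_int k" "z \<in> \<rat>" "z \<noteq> 0" "\<bar>z\<bar> \<le> 4"
    and M: "M \<in> ordered_bases" and opt: "basis_set M \<in> SIVP_opt (shear p q y)"
  obtains r s m where "s = 1 \<or> s = -1" "M $ r $ q = 8 * of_int s"
    "M $ r $ p = 8 * of_int m + z * of_int s" "\<bar>M $ r $ p\<bar> \<le> \<bar>z\<bar>" "\<And>i. i \<noteq> r \<Longrightarrow> M $ i $ q = 0"
proof -
  let ?C = "sqrt (z\<^sup>2 + 64)" and ?S = "shear p q z"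
  have C: "?C > 8" using z(3) real_less_rsqrt[of 8 "z\<^sup>2 + 64"] by simp
  have injM: "inj (\<lambda>i. M $ i)" and basM: "Rc_basis (basis_set M)"
    using M by (auto simp: ordered_bases_def)
  have lat: "M $ i \<in> lattice_of (shear p q y)" for i
    using opt by (auto simp: SIVP_opt_def is_arg_min_def lattice_bases_def basis_set_def)
  have "basis_set ?S \<in> lattice_bases (shear p q y)"
    using shear_rows_lattice[OF pq z(1)] shear_ordered_basis[OF pq z(2)]
    by (auto simp: lattice_bases_def ordered_bases_def)
  then have "(\<Sum>b\<in>basis_set M. norm b) \<le> (\<Sum>b\<in>basis_set ?S. norm b)"
    using opt by (auto simp: SIVP_opt_def is_arg_min_linorder)
  then have le: "(\<Sum>i\<in>UNIV. norm (M $ i)) \<le> (\<Sum>i\<in>UNIV. norm (?S $ i))"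
    by (simp add: sum_basis_set injM inj_shear[OF pq])
  have S: "norm (?S $ i) = (if i = q then ?C else 8)" for i
  proof -
    have "(norm (?S $ i))\<^sup>2 = (\<Sum>j\<in>UNIV. (?S $ i $ j)\<^sup>2)"
      by (simp add: norm_vec_def L2_set_def sum_nonneg)
    also have "\<dots> = (\<Sum>j\<in>UNIV. (if j = i then 64 else 0) + (if j = p then if i = q then z\<^sup>2 else 0 else 0))"
      using pq by (intro sum.cong) (auto simp: shear_def)
    also have "\<dots> = (if i = q then z\<^sup>2 + 64 else 8\<^sup>2)" by (simp add: sum.distrib)
    finally show ?thesis
      by (metis abs_norm_cancel abs_numeral real_sqrt_abs)
  qed
  have nz: "M $ i \<noteq> 0" for i
  proof
    assume 0: "M $ i = 0"
    define c where "c b = (if b = 0 then 1 else 0 :: real)" for b :: "real ^ 'n"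
    have "(\<Sum>b\<in>basis_set M. c b *\<^sub>R b) = 0" by (intro sum.neutral) (auto simp: c_def)
    moreover have "\<forall>b\<in>basis_set M. c b \<in> Rc" by (auto simp: c_def intro: Rats_Rc)
    ultimately have "\<forall>b\<in>basis_set M. c b = 0"
      using basM unfolding Rc_basis_def Rc_independent_def by blast
    then have "c (M $ i) = 0" by (simp add: basis_set_def)
    then show False using 0 by (simp add: c_def)
  qed
  obtain l :: "'n \<Rightarrow> 'n \<Rightarrow> int" where
    l: "\<And>i j. M $ i $ j = 8 * of_int (l i j) + (if j = p then z * of_int (l i q) else 0)"
  proof -
    have "\<exists>l :: 'n \<Rightarrow> int. \<forall>j. M $ i $ j = 8 * of_int (l j) + (if j = p then z * of_int (l q) else 0)" for i
      using shear_lattice_coords[OF pq z(1) lat[of i]] by metis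
    then show ?thesis using that by metis
  qed
  \<comment> \<open>Either the \<open>q\<close>-entry is a nonzero multiple of 8, or all entries are
    multiples of 8 and one of them is not \<open>0\<close>.\<close>
  have ge8: "8 \<le> norm (M $ i)" for i
  proof -
    obtain j where "l i j \<noteq> 0" "j \<noteq> p \<or> l i q = 0"
    proof (cases "l i q = 0")
      case True
      obtain j where "M $ i $ j \<noteq> 0" using nz[of i] by (auto simp: vec_eq_iff)
      with True show ?thesis using that[of j] l[of i j] by (auto split: if_splits)
    next
      case False
      then show ?thesis using that[of q] pq by auto
    qed
    then have "\<bar>M $ i $ j\<bar> = 8 * \<bar>of_int (l i j)\<bar>" "\<bar>real_of_int (l i j)\<bar> \<ge> 1" using l[of i j] by auto
    then show ?thesis using component_le_norm_cart[of "M $ i" j] by linarith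
  qed
  have sq: "z\<^sup>2 + 64 \<le> (M $ i $ p)\<^sup>2 + (M $ i $ q)\<^sup>2" if "l i q \<noteq> 0" for i
    using shifted_multiple_ge[OF that z(4), of "l i p"] l[of i p] l[of i q] pq by simp
  have geC: "?C \<le> norm (M $ i)" if "l i q \<noteq> 0" for i
    using sq[OF that] norm_ge_two_components[OF pq, of "M $ i"] by (intro real_le_lsqrt) auto
  \<comment> \<open>The rows span this unit vector, so they cannot all vanish in coordinate
    \<open>q\<close>.\<close>
  have "axis q 1 \<in> Rc_span (basis_set M)"
    using basM by (auto simp: Rc_basis_def Rc_vectors_def axis_def intro: Rats_Rc)
  then obtain c where c: "axis q 1 = (\<Sum>b\<in>basis_set M. c b *\<^sub>R b)" unfolding Rc_span_def by blast
  have "(\<Sum>b\<in>basis_set M. c b *\<^sub>R b) $ q \<noteq> 0" unfolding c[symmetric] by simp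
  then have "(\<Sum>i\<in>UNIV. c (M $ i) * (M $ i $ q)) \<noteq> 0"
    by (simp add: sum_basis_set[OF injM] sum_component)
  then obtain r where "M $ r $ q \<noteq> 0" by (metis (no_types, lifting) mult_zero_right sum.neutral)
  then have lr: "l r q \<noteq> 0" using l[of r q] pq by auto
  have tot: "norm (M $ r) + (\<Sum>i\<in>UNIV - {r}. norm (M $ i)) \<le> ?C + (\<Sum>i\<in>UNIV - {r}. 8)"
  proof -
    have "(\<Sum>i\<in>UNIV. norm (?S $ i)) = ?C + (\<Sum>i\<in>UNIV - {q}. 8)"
      unfolding S by (subst sum.remove[of _ q]) auto
    moreover have "(\<Sum>i\<in>UNIV. norm (M $ i)) = norm (M $ r) + (\<Sum>i\<in>UNIV - {r}. norm (M $ i))"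
      by (rule sum.remove) auto
    ultimately show ?thesis using le by (simp add: card_Diff_singleton)
  qed
  have ge: "(\<Sum>i\<in>UNIV - {r}. 8) \<le> (\<Sum>i\<in>UNIV - {r}. norm (M $ i))"
    using ge8 by (intro sum_mono) auto
  have other: "M $ i $ q = 0" if "i \<noteq> r" for i
  proof (rule ccontr)
    assume "M $ i $ q \<noteq> 0"
    then have "l i q \<noteq> 0" using l[of i q] pq by auto
    \<comment> \<open>Here \<open>z \<noteq> 0\<close> matters: a second row with nonzero
      \<open>q\<close>-entry is strictly longer than the 8 available for it.\<close>
    then have "8 < norm (M $ i)" using geC C by fastforce
    then have "(\<Sum>i\<in>UNIV - {r}. 8) < (\<Sum>i\<in>UNIV - {r}. norm (M $ i))"
      using ge8 that by (intro sum_strict_mono_ex1) auto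
    then show False using tot geC[OF lr] by linarith
  qed
  have "norm (M $ r) \<le> ?C" using tot ge by linarith
  then have "(norm (M $ r))\<^sup>2 \<le> ?C\<^sup>2" by (intro power_mono) auto
  then have up: "(M $ r $ p)\<^sup>2 + (M $ r $ q)\<^sup>2 \<le> z\<^sup>2 + 64"
    using norm_ge_two_components[OF pq, of "M $ r"] by simp
  have "z\<^sup>2 \<le> 4\<^sup>2" using z(4) by (metis abs_le_square_iff abs_numeral)
  then have "z\<^sup>2 \<le> 16" by simp
  \<comment> \<open>The entry is \<open>8 * l r q\<close>, and a coefficient of absolute value 2
    would already give 256.\<close>
  then have "(M $ r $ q)\<^sup>2 \<le> 80" using up zero_le_power2[of "M $ r $ p"] by linarith
  then have "(real_of_int (l r q))\<^sup>2 < 2\<^sup>2" using l[of r q] pq by (simp add: power_mult_distrib)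
  then have "\<bar>real_of_int (l r q)\<bar> < 2" using power_less_imp_less_base[of "\<bar>real_of_int (l r q)\<bar>" 2 2] by simp
  then have s: "l r q = 1 \<or> l r q = -1" using lr by linarith
  then have "(M $ r $ q)\<^sup>2 = 64" using l[of r q] pq by auto
  then have "\<bar>M $ r $ p\<bar> \<le> \<bar>z\<bar>" using up by (simp add: abs_le_square_iff)
  then show ?thesis using that[of "l r q" r "l r p"] s other l[of r q] l[of r p] pq by auto
qed

section \<open>Reduction of the halting problem to near-optimal solutions\<close>

lemma computable_vec_seq_matrix:
  fixes a :: "nat \<Rightarrow> real ^ 'n::finite ^ 'n"
  shows "computable_vec_seq a \<longleftrightarrow> (\<forall>i j. computable_real_seq (\<lambda>l. a l $ i $ j))"
proof -
  have eq: "(Basis :: (real ^ 'n ^ 'n) set) = (\<Union>i j. {axis i (axis j 1)})"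
    by (auto simp: Basis_vec_def)
  show ?thesis unfolding computable_vec_seq_def eq by (auto simp: inner_axis)
qed

lemma near_optimal_not_computable:
  fixes G G' :: "real ^ 'n::finite ^ 'n \<Rightarrow> real ^ 'n ^ 'n"
  assumes n: "CARD('n) \<ge> 2"
    and maps: "\<And>B. B \<in> ordered_bases \<Longrightarrow> G B \<in> ordered_bases"
    and opt: "\<And>B. B \<in> ordered_bases \<Longrightarrow> basis_set (G B) \<in> SIVP_opt B"
    and near: "\<And>B. B \<in> ordered_bases \<Longrightarrow> norm (G B - G' B) \<le> 1"
  shows "\<not> banach_mazur_computable_on ordered_bases G'"
proof
  assume bm: "banach_mazur_computable_on ordered_bases G'"
  obtain p q :: 'n where pq: "p \<noteq> q"
    using n card_le_Suc0_iff_eq[of "UNIV :: 'n set"] by fastforce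
  let ?S = "shear p q"
  note ob = shear_ordered_basis[OF pq]
  have S4: "?S 4 \<in> ordered_bases" by (rule ob) simp
  have e4: "(4::real) = 4 + 8 * of_int 0" by simp
  obtain r0 s0 m0 where M0: "s0 = 1 \<or> s0 = -1" "G (?S 4) $ r0 $ q = 8 * of_int s0"
    "G (?S 4) $ r0 $ p = 8 * of_int m0 + 4 * of_int s0" "\<bar>G (?S 4) $ r0 $ p\<bar> \<le> 4"
    "\<And>i. i \<noteq> r0 \<Longrightarrow> G (?S 4) $ i $ q = 0"
    by (rule shear_optimal_rows[OF pq e4 _ _ _ maps[OF S4] opt[OF S4]]) auto
  let ?a0 = "G (?S 4) $ r0 $ p"
  \<comment> \<open>The entry is 4 times the odd number \<open>2 * m0 + s0\<close>, and its absolute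
    value is at most 4.\<close>
  have a0: "?a0 = 4 \<or> ?a0 = -4"
  proof -
    have "\<bar>2 * m0 + s0\<bar> \<le> 1" using M0(3,4) by linarith
    then have "2 * m0 + s0 = 1 \<or> 2 * m0 + s0 = -1" using M0(1) by presburger
    moreover have "?a0 = 4 * of_int (2 * m0 + s0)" using M0(3) by simp
    ultimately show ?thesis by auto
  qed
  \<comment> \<open>After normalising the sign of the \<open>q\<close>-entry, \<open>G\<close> has
    chosen \<open>(4, 8)\<close> or \<open>(-4, 8)\<close> at the tie. Above 4 the optimal vector is
    near \<open>(-4, 8)\<close>, below 4 near \<open>(4, 8)\<close>; \<open>d\<close> points to the
    side where it is the other one.\<close>
  define d :: real where "d = (if of_int s0 * ?a0 = 4 then 1 else -1)"
  define B where "B l = ?S (4 + d * halt_real l)" for l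
  have rat: "4 + d * halt_real l \<in> \<rat>" for l using halt_real_Rats by (auto simp: d_def)
  have B: "B l \<in> ordered_bases" for l unfolding B_def by (rule ob[OF rat])
  have "computable_real_seq (\<lambda>l. B l $ i $ j)" for i j
  proof (cases "i = q \<and> j = p")
    case True
    then have "(\<lambda>l. B l $ i $ j) = (\<lambda>l. 4 + d * halt_real l)" using pq by (auto simp: B_def shear_def)
    moreover have "computable_real_seq (\<lambda>l. 4 + d * halt_real l)"
      by (rule computable_real_seq_halt_real) (auto simp: d_def)
    ultimately show ?thesis by (simp only:)
  next
    case False
    then have "(\<lambda>l. B l $ i $ j) = (\<lambda>l. if i = j then 8 else 0)" by (auto simp: B_def shear_def)
    moreover have "computable_real_seq (\<lambda>l. if i = j then 8 else 0)"
      by (rule computable_real_seq_const) auto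
    ultimately show ?thesis by (simp only:)
  qed
  then have "computable_vec_seq B" by (simp add: computable_vec_seq_matrix)
  then have "computable_vec_seq (\<lambda>l. G' (B l))"
    using bm B unfolding banach_mazur_computable_on_def by blast
  then have comp: "computable_real_seq (\<lambda>l. G' (B l) $ i $ j)" for i j
    by (simp add: computable_vec_seq_matrix)
  have far: "\<exists>i j. \<bar>G (B l) $ i $ j - G (?S 4) $ i $ j\<bar> \<ge> 7" if h: "halt_real l > 0" for l
  proof -
    define z where "z = (if d = 1 then halt_real l - 4 else 4 - halt_real l)"
    have z: "4 + d * halt_real l + 8 * of_int (if d = 1 then -1 else 0) = z"
      by (auto simp: z_def d_def)
    have zr: "z \<in> \<rat>" using halt_real_Rats by (auto simp: z_def)
    have "z \<noteq> 0" "\<bar>z\<bar> \<le> 4" using h halt_real_bounds(2)[of l] by (auto simp: z_def)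
    with shear_optimal_rows[OF pq z[symmetric] zr _ _ maps[OF B[of l]]] opt[OF B[of l]]
    obtain r s m where M: "s = 1 \<or> s = -1" "G (B l) $ r $ q = 8 * of_int s"
      "G (B l) $ r $ p = 8 * of_int m + z * of_int s" "\<bar>G (B l) $ r $ p\<bar> \<le> \<bar>z\<bar>"
      unfolding B_def by metis
    \<comment> \<open>Away from the tie \<open>\<bar>z\<bar> < 4\<close>, so any nonzero shift by
      multiples of 8 gives an entry larger than \<open>\<bar>z\<bar>\<close>.\<close>
    have m: "m = 0"
    proof (rule ccontr)
      assume "m \<noteq> 0"
      then have "8 \<le> \<bar>8 * real_of_int m\<bar>" by linarith
      moreover have "\<bar>z * of_int s\<bar> = \<bar>z\<bar>" using M(1) by auto
      moreover have "\<bar>z\<bar> < 4" using h halt_real_bounds(2)[of l] by (auto simp: z_def)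
      ultimately show False using M(3,4) by linarith
    qed
    show ?thesis
    \<comment> \<open>With the same row and sign, the \<open>p\<close>-entries lie near opposite
      values 4 and -4, at distance \<open>8 - halt_real l\<close>. Otherwise the
      \<open>q\<close>-entries of row \<open>r\<close> differ by 8 or 16.\<close>
    proof (cases "r = r0 \<and> s = s0")
      case True
      have "\<bar>z * of_int s0 - ?a0\<bar> \<ge> 7"
        using M0(1) a0 h halt_real_bounds(2)[of l] by (auto simp: z_def d_def)
      then have "\<bar>G (B l) $ r $ p - G (?S 4) $ r $ p\<bar> \<ge> 7"
        using True M(3) m by simp
      then show ?thesis by blast
    next
      case False
      then have "\<bar>G (B l) $ r $ q - G (?S 4) $ r $ q\<bar> \<ge> 8"
        using M(1,2) M0(1,2,5) by (cases "r = r0") auto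
      then show ?thesis by (intro exI[of _ r] exI[of _ q]) linarith
    qed
  qed
  have entry: "\<bar>G M $ i $ j - G' M $ i $ j\<bar> \<le> 1" if "M \<in> ordered_bases" for M i j
  proof -
    have "\<bar>(G M - G' M) $ i $ j\<bar> \<le> norm ((G M - G' M) $ i)" by (rule component_le_norm_cart)
    also have "\<dots> \<le> norm (G M - G' M)" by (rule Finite_Cartesian_Product.norm_nth_le)
    finally show ?thesis using near[OF that] by simp
  qed
  \<comment> \<open>Rounding replaces the real entries at the tie by rational constants, with which
    computable comparison is possible.\<close>
  define c :: "'n \<times> 'n \<Rightarrow> real" where "c = (\<lambda>(i, j). of_int \<lfloor>G' (?S 4) $ i $ j\<rfloor>)"
  show False
  proof (rule no_separating_family[of UNIV "\<lambda>(i, j) l. G' (B l) $ i $ j" c])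
    fix l :: nat and ij :: "'n \<times> 'n"
    obtain i j where ij: "ij = (i, j)" by fastforce
    show "computable_real_seq ((\<lambda>(i, j) l. G' (B l) $ i $ j) ij)" using comp ij by simp
    show "c ij \<in> \<rat>" using ij by (simp add: c_def)
    assume "halt_real l = 0"
    then have "B l = ?S 4" by (simp add: B_def)
    then show "\<bar>(case ij of (i, j) \<Rightarrow> \<lambda>l. G' (B l) $ i $ j) l - c ij\<bar> \<le> 1"
      using ij by (simp add: c_def) linarith
  next
    fix l :: nat assume "halt_real l > 0"
    then obtain i j where "\<bar>G (B l) $ i $ j - G (?S 4) $ i $ j\<bar> \<ge> 7" using far by blast
    moreover have "\<bar>G (B l) $ i $ j - G' (B l) $ i $ j\<bar> \<le> 1" by (rule entry[OF B])
    moreover have "\<bar>G (?S 4) $ i $ j - G' (?S 4) $ i $ j\<bar> \<le> 1" by (rule entry[OF S4])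
    moreover have "\<bar>G' (?S 4) $ i $ j - c (i, j)\<bar> \<le> 1" by (simp add: c_def) linarith
    ultimately have "3 < \<bar>G' (B l) $ i $ j - c (i, j)\<bar>" by linarith
    then show "\<exists>ij\<in>UNIV. 3 < \<bar>(case ij of (i, j) \<Rightarrow> \<lambda>l. G' (B l) $ i $ j) l - c ij\<bar>"
      by (intro bexI[of _ "(i, j)"]) auto
  qed simp
qed

theorem theorem6:
  fixes G :: "real ^ 'n ^ 'n \<Rightarrow> real ^ 'n ^ 'n"
  assumes n: "CARD('n) \<ge> 2"
    and G_maps: "G \<in> ordered_bases \<rightarrow> ordered_bases"
    and G_opt: "\<And>B. B \<in> ordered_bases \<Longrightarrow> basis_set (G B) \<in> SIVP_opt B"
  shows "\<not> banach_mazur_computable_on ordered_bases G \<and>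
    (\<forall>(G' :: real ^ 'n ^ 'n \<Rightarrow> real ^ 'n ^ 'n) (\<alpha> :: real).
       G' \<in> ordered_bases \<rightarrow> ordered_bases \<and>
       sup_dist_on ordered_bases G G' \<le> ereal \<alpha> \<and> \<alpha> < sqrt 2 / 2 \<longrightarrow>
       \<not> banach_mazur_computable_on ordered_bases G')"
proof (intro conjI allI impI)
  have maps: "\<And>B. B \<in> ordered_bases \<Longrightarrow> G B \<in> ordered_bases" using G_maps by auto
  show "\<not> banach_mazur_computable_on ordered_bases G"
    by (rule near_optimal_not_computable[OF n maps G_opt]) auto
  fix G' :: "real ^ 'n ^ 'n \<Rightarrow> real ^ 'n ^ 'n" and \<alpha> :: real
  assume *: "G' \<in> ordered_bases \<rightarrow> ordered_bases \<and>
       sup_dist_on ordered_bases G G' \<le> ereal \<alpha> \<and> \<alpha> < sqrt 2 / 2"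
  have near: "norm (G B - G' B) \<le> 1" if "B \<in> ordered_bases" for B
  proof -
    have "ereal (norm (G B - G' B)) \<le> sup_dist_on ordered_bases G G'"
      unfolding sup_dist_on_def using that by (rule SUP_upper)
    also have "\<dots> \<le> ereal \<alpha>" using * by blast
    finally have "norm (G B - G' B) \<le> \<alpha>" by simp
    \<comment> \<open>Hence \<open>\<alpha>\<close> lies below the tolerance 1 for which the scale
      of the lattices was chosen.\<close>
    moreover have "sqrt 2 \<le> 2" by (simp add: real_le_lsqrt)
    ultimately show ?thesis using * by linarith
  qed
  show "\<not> banach_mazur_computable_on ordered_bases G'"
    by (rule near_optimal_not_computable[OF n maps G_opt near])
qed

end
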